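(* Let $\Phi:\mathbb{R}^d\times\mathbb{R}^n\to\mathbb{R}$ be differentiable and let $h:\mathbb{R}^n\to\mathbb{R}\cup\{+\infty\}$ be proper, lower semicontinuous and convex. Assume there are constants $L_{xx},L_{xy},L_{yx},L_{yy},\mu,\rho>0$ such that: (1) for all $x,x_1,x_2\in\mathbb{R}^d$ and $y,y_1,y_2\in\mathbb{R}^n$: $\|\nabla_x\Phi(x_1,y)-\nabla_x\Phi(x_2,y)\|\le L_{xx}\|x_1-x_2\|$, $\|\nabla_x\Phi(x,y_1)-\nabla_x\Phi(x,y_2)\|\le L_{xy}\|y_1-y_2\|$, $\|\nabla_y\Phi(x_1,y)-\nabla_y\Phi(x_2,y)\|\le L_{yx}\|x_1-x_2\|$, $\|\nabla_y\Phi(x,y_1)-\nabla_y\Phi(x,y_2)\|\le L_{yy}\|y_1-y_2\|$; (2) $\Phi(x,\cdot)$ is concave for every $x\in\mathbb{R}^d$, and either $\Phi(x,\cdot)$ is $\mu$-strongly concave for every $x\in\mathbb{R}^d$ or $h$ is $\mu$-strongly convex; (3) $\Phi(\cdot,y)$ is $\rho$-weakly convex for every $y\in\mathbb{R}^n$; (4) the function $\varphi(x)=\max_{y\in\mathbb{R}^n}\{\Phi(x,y)-h(y)\}$ satisfies $\inf_{x\in\mathbb{R}^d}\varphi(x)>-\infty$; (5) $\kappa_y:=L_{yy}/\mu\ge 1$. Let the step-sizes satisfy $$0<\eta_y\le\frac{1}{L_{yy}},\qquad 0<\eta_x<\min\left(\frac{\eta_y L_{yy}\,\mu}{\sqrt2\,L_{xy}L_{yx}\,(\sqrt2\,\kappa_y+\eta_y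 L_{yy})},\ \frac1\rho\right).$$ For any $(x_0,y_0)\in\mathbb{R}^d\times\mathbb{R}^n$, let $(x_k,y_k)_{k\ge0}$ be defined for all $k\ge 0$ by $$x_{k+1}=\operatorname{prox}_{\eta_x\Phi(\cdot,y_k)}(x_k),\qquad y_{k+1}=\operatorname{prox}_{\eta_y h}\big(y_k+\eta_y\nabla_y\Phi(x_{k+1},y_k)\big).$$ Then for every $\varepsilon>0$ there exists $k=\mathcal{O}(\varepsilon^{-2})$ such that $\|\nabla\varphi(x_k)\|<\varepsilon$; that is, there is a constant $C>0$ independent of $\varepsilon$ such that for every $\varepsilon>0$ there is an integer $0\le k\le C\varepsilon^{-2}$ with $\|\nabla\varphi(x_k)\|<\varepsilon$.
   Context: $\|\cdot\|$ is the Euclidean norm; $\nabla_x,\nabla_y$ are partial gradients. A function $g$ is $\alpha$-strongly convex if $g-\frac{\alpha}{2}\|\cdot\|^2$ is convex, $\alpha$-weakly convex if $g+\frac{\alpha}{2}\|\cdot\|^2$ is convex, and $\alpha$-strongly concave if $-g$ is $\alpha$-strongly convex. For $\eta>0$, $\operatorname{prox}_{\eta g}(v)=\operatorname{argmin}_{z}\{g(z)+\frac{1}{2\eta}\|z-v\|^2\}$, which is a single point when $g$ is proper, lower semicontinuous and $\rho$-weakly convex with $\eta\rho<1$ (in particular for convex $g$ and any $\eta>0$). Under the stated assumptions the maximizer $y^*(x)=\operatorname{argmax}_y\{\Phi(x,y)-h(y)\}$ is unique, and $\varphi$ is $C^1$ with $\nabla\varphi(x)=\nabla_x\Phi(x,y^*(x))$.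 *)

theory Defs
  imports "HOL-Analysis.Analysis"
begin

text \<open>Meaningful only where \<open>f\<close> is differentiable; the vector is then unique.\<close>
definition gradient :: "('a::real_inner \<Rightarrow> real) \<Rightarrow> 'a \<Rightarrow> 'a" where
  "gradient f x = (THE D. GDERIV f x :> D)"

definition strongly_concave :: "real \<Rightarrow> ('a::real_inner \<Rightarrow> real) \<Rightarrow> bool" where
  "strongly_concave \<alpha> g \<longleftrightarrow> convex_on UNIV (\<lambda>x. - g x - \<alpha> / 2 * (norm x)\<^sup>2)"

definition weakly_convex :: "real \<Rightarrow> ('a::real_inner \<Rightarrow> real) \<Rightarrow> bool" where
  "weakly_convex \<alpha> g \<longleftrightarrow> convex_on UNIV (\<lambda>x. g x + \<alpha> / 2 * (norm x)\<^sup>2)"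

definition proper :: "('a \<Rightarrow> ereal) \<Rightarrow> bool" where
  "proper g \<longleftrightarrow> (\<forall>x. g x \<noteq> -\<infinity>) \<and> (\<exists>x. g x \<noteq> \<infinity>)"

definition lower_semicontinuous :: "('a::topological_space \<Rightarrow> ereal) \<Rightarrow> bool" where
  "lower_semicontinuous g \<longleftrightarrow> (\<forall>x. g x \<le> Liminf (at x) g)"

text \<open>Intended for functions that never take the value \<open>-\<infinity>\<close>, so that the right-hand side
  contains no \<open>\<infinity> - \<infinity>\<close>; recall that \<open>0 * \<infinity> = 0\<close> in \<open>ereal\<close>.\<close>
definition ereal_convex :: "('a::real_vector \<Rightarrow> ereal) \<Rightarrow> bool" where
  "ereal_convex g \<longleftrightarrow> (\<forall>x y. \<forall>u\<ge>0. \<forall>v\<ge>0. u + v = 1 \<longrightarrow>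
     g (u *\<^sub>R x + v *\<^sub>R y) \<le> ereal u * g x + ereal v * g y)"

definition ereal_strongly_convex :: "real \<Rightarrow> ('a::real_inner \<Rightarrow> ereal) \<Rightarrow> bool" where
  "ereal_strongly_convex \<alpha> g \<longleftrightarrow> ereal_convex (\<lambda>x. g x - ereal (\<alpha> / 2 * (norm x)\<^sup>2))"

text \<open>\<open>arg_min\<close> selects some minimizer; it is the proximal point whenever the minimizer exists
  and is unique, e.g. for \<open>g\<close> proper, lower semicontinuous and \<open>\<rho>\<close>-weakly convex with
  \<open>\<eta> * \<rho> < 1\<close>.\<close>
definition prox :: "real \<Rightarrow> ('a::real_inner \<Rightarrow> ereal) \<Rightarrow> 'a \<Rightarrow> 'a" where
  "prox \<eta> g v = (ARG_MIN (\<lambda>z. g z + ereal (1 / (2 * \<eta>) * (norm (z - v))\<^sup>2)) z. True)"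

text \<open>The maximum (\<open>GREATEST\<close> is the largest element of the set of values, not merely a
  supremum) is attained and finite if \<open>\<Phi> (x, \<cdot>)\<close> is concave and continuous, \<open>h\<close> is proper, lower
  semicontinuous and convex, and one of the two is strongly concave resp. strongly convex.\<close>
definition max_fun :: "('a \<times> 'b \<Rightarrow> real) \<Rightarrow> ('b \<Rightarrow> ereal) \<Rightarrow> 'a \<Rightarrow> real" where
  "max_fun \<Phi> h x =
     real_of_ereal (GREATEST m. m \<in> range (\<lambda>y. ereal (\<Phi> (x, y)) - h y))"

definition grad_x ::
    "('a::real_inner \<times> 'b \<Rightarrow> real) \<Rightarrow> 'a \<Rightarrow> 'b \<Rightarrow> 'a" where
  "grad_x \<Phi> x y = gradient (\<lambda>x'. \<Phi> (x', y)) x"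

definition grad_y ::
    "('a \<times> 'b::real_inner \<Rightarrow> real) \<Rightarrow> 'a \<Rightarrow> 'b \<Rightarrow> 'b" where
  "grad_y \<Phi> x y = gradient (\<lambda>y'. \<Phi> (x, y')) y"

end

theory Submission
  imports Defs
begin

text \<open>
  Let \<open>y*\<close> be the maximizer map, \<open>D\<^sub>k = \<parallel>x\<^sub>k\<^sub>+\<^sub>1 - x\<^sub>k\<parallel>\<close>, \<open>e\<^sub>k = \<parallel>y\<^sub>k - y*(x\<^sub>k\<^sub>+\<^sub>1)\<parallel>\<close> and
  \<open>s\<^sub>k = \<parallel>y*(x\<^sub>k\<^sub>+\<^sub>1) - y*(x\<^sub>k)\<parallel>\<close>. The proximal gradient step contracts towards the maximizer with factor
  \<open>q = 1 / (1 + \<eta>y \<mu>)\<close>, so \<open>e\<^sub>k\<^sub>+\<^sub>1 \<le> q e\<^sub>k + s\<^sub>k\<^sub>+\<^sub>1\<close>, and \<open>s\<^sub>k \<le> L / \<mu> D\<^sub>k\<close>. Weak convexity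
  together with the quadratic growth of \<open>\<Phi>(x\<^sub>k, \<cdot>) - h\<close> around its maximizer yields
  \<open>\<phi>(x\<^sub>k\<^sub>+\<^sub>1) + D\<^sub>k\<^sup>2 / (2 \<eta>x) \<le> \<phi>(x\<^sub>k) + L e\<^sub>k D\<^sub>k - \<mu> / 2 s\<^sub>k\<^sup>2\<close>.
  The term \<open>- \<mu> / 2 s\<^sub>k\<^sup>2\<close> is essential: without it the stated range of \<open>\<eta>x\<close> is slightly too large for
  the argument. To exploit it, \<open>L\<close> has to serve as a Lipschitz constant for both mixed
  dependencies; by a second-difference argument \<open>L = min Lxy Lyx\<close> does. Then
  \<open>\<phi>(x\<^sub>k\<^sub>+\<^sub>1) + c e\<^sub>k\<^sup>2\<close> is a Lyapunov function whose decrease dominates \<open>\<parallel>\<nabla>\<phi>(x\<^sub>k\<^sub>+\<^sub>1)\<parallel>\<^sup>2\<close>, so the squared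
  gradient norms are summable.
\<close>

section \<open>Convexity and smoothness\<close>

lemma GDERIV_line:
  fixes f :: "'a::real_inner \<Rightarrow> real"
  assumes "GDERIV f (z + t *\<^sub>R d) :> g"
  shows "((\<lambda>s. f (z + s *\<^sub>R d)) has_real_derivative g \<bullet> d) (at t)"
proof -
  have "((\<lambda>s. z + s *\<^sub>R d) has_derivative (\<lambda>s. s *\<^sub>R d)) (at t)"
    by (auto intro!: derivative_eq_intros)
  then have "((\<lambda>s. f (z + s *\<^sub>R d)) has_derivative (\<lambda>s. (s *\<^sub>R d) \<bullet> g)) (at t)"
    using assms unfolding gderiv_def by (rule has_derivative_compose)
  then show ?thesis
    by (simp add: has_field_derivative_def inner_commute mult_commute_abs)
qed

lemma GDERIV_directional:
  fixes f :: "'a::real_inner \<Rightarrow> real"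
  assumes "GDERIV f z :> g"
  shows "((\<lambda>t. (f (z + t *\<^sub>R d) - f z) / t) \<longlongrightarrow> g \<bullet> d) (at_right 0)"
proof -
  have "((\<lambda>s. f (z + s *\<^sub>R d)) has_real_derivative g \<bullet> d) (at 0)"
    by (rule GDERIV_line) (use assms in simp)
  then show ?thesis
    by (auto simp: has_field_derivative_iff intro: filterlim_mono at_le)
qed

text \<open>Differentiating along \<open>g\<close> itself turns the one-sided growth bound into
  \<open>g \<bullet> g \<le> K * norm g\<close>.\<close>

lemma norm_gradient_le_Lipschitz:
  fixes f :: "'a::real_inner \<Rightarrow> real"
  assumes "GDERIV f z :> g" and lip: "\<And>w. f w - f z \<le> K * norm (w - z)" and "0 \<le> K"
  shows "norm g \<le> K"
proof -
  have "((\<lambda>t. (f (z + t *\<^sub>R g) - f z) / t) \<longlongrightarrow> g \<bullet> g) (at_right 0)"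
    by (rule GDERIV_directional[OF assms(1)])
  moreover have "\<forall>\<^sub>F t in at_right (0::real). (f (z + t *\<^sub>R g) - f z) / t \<le> K * norm g"
    using eventually_at_right_less[of "0::real"]
  proof eventually_elim
    case (elim t)
    then show ?case using lip[of "z + t *\<^sub>R g"] by (simp add: field_simps)
  qed
  ultimately have "g \<bullet> g \<le> K * norm g"
    by (intro tendsto_upperbound) auto
  then have "norm g * norm g \<le> K * norm g"
    by (simp add: dot_square_norm power2_eq_square)
  then show ?thesis
    using \<open>0 \<le> K\<close> by (cases "g = 0") auto
qed

text \<open>Expanding the squared norm of a convex combination isolates the quadratic gain. The sign
  of \<open>m\<close> is free, so weak convexity is the case of a negative modulus.\<close>

lemma strongly_convex_segment:
  fixes h :: "'a::real_inner \<Rightarrow> real"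
  assumes "convex_on S (\<lambda>y. h y - m / 2 * (norm y)\<^sup>2)"
    and "z \<in> S" "w \<in> S" "0 \<le> t" "t \<le> 1"
  shows "z + t *\<^sub>R (w - z) \<in> S"
    and "h (z + t *\<^sub>R (w - z)) + m / 2 * (t * (1 - t)) * (norm (w - z))\<^sup>2 \<le> (1 - t) * h z + t * h w"
proof -
  have eq: "z + t *\<^sub>R (w - z) = (1 - t) *\<^sub>R z + t *\<^sub>R w"
    by (simp add: algebra_simps)
  have "convex S"
    using assms(1) by (rule convex_on_imp_convex)
  then show "z + t *\<^sub>R (w - z) \<in> S"
    unfolding eq using assms by (intro convexD) auto
  have "h ((1 - t) *\<^sub>R z + t *\<^sub>R w) - m / 2 * (norm ((1 - t) *\<^sub>R z + t *\<^sub>R w))\<^sup>2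
      \<le> (1 - t) * (h z - m / 2 * (norm z)\<^sup>2) + t * (h w - m / 2 * (norm w)\<^sup>2)"
    using convex_onD[OF assms(1), of t z w] assms by simp
  moreover have "(norm ((1 - t) *\<^sub>R z + t *\<^sub>R w))\<^sup>2
      = (1 - t) * (norm z)\<^sup>2 + t * (norm w)\<^sup>2 - t * (1 - t) * (norm (w - z))\<^sup>2"
    unfolding power2_norm_eq_inner
    by (simp add: inner_simps inner_commute algebra_simps power2_eq_square)
  ultimately have "h ((1 - t) *\<^sub>R z + t *\<^sub>R w)
      - m / 2 * ((1 - t) * (norm z)\<^sup>2 + t * (norm w)\<^sup>2 - t * (1 - t) * (norm (w - z))\<^sup>2)
      \<le> (1 - t) * (h z - m / 2 * (norm z)\<^sup>2) + t * (h w - m / 2 * (norm w)\<^sup>2)"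
    by simp
  then show "h (z + t *\<^sub>R (w - z)) + m / 2 * (t * (1 - t)) * (norm (w - z))\<^sup>2
      \<le> (1 - t) * h z + t * h w"
    unfolding eq by (simp add: algebra_simps add_divide_distrib diff_divide_distrib)
qed

text \<open>Minimality is tested along the segment from \<open>z\<close> to \<open>w\<close>,
  divided by \<open>t\<close>, and \<open>t\<close> sent to 0. Only \<open>h\<close> carries
  convexity; \<open>f\<close> enters through its gradient at \<open>z\<close>. Proximal points,
  maximizers and tangent bounds all rest on this inequality.\<close>

lemma variational_inequality:
  fixes f h :: "'a::real_inner \<Rightarrow> real"
  assumes g: "GDERIV f z :> g" and conv: "convex_on S (\<lambda>y. h y - m / 2 * (norm y)\<^sup>2)"
    and z: "z \<in> S" and w: "w \<in> S" and min: "\<And>y. y \<in> S \<Longrightarrow> f z + h z \<le> f y + h y"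
  shows "h z + m / 2 * (norm (w - z))\<^sup>2 \<le> h w + g \<bullet> (w - z)"
proof -
  have "((\<lambda>t. (f (z + t *\<^sub>R (w - z)) - f z) / t) \<longlongrightarrow> g \<bullet> (w - z)) (at_right 0)"
    by (rule GDERIV_directional[OF g])
  moreover have "((\<lambda>t. h z - h w + m / 2 * (1 - t) * (norm (w - z))\<^sup>2) \<longlongrightarrow>
      h z - h w + m / 2 * (1 - 0) * (norm (w - z))\<^sup>2) (at_right 0)"
    by (intro tendsto_intros)
  moreover have "\<forall>\<^sub>F t in at_right (0::real).
      h z - h w + m / 2 * (1 - t) * (norm (w - z))\<^sup>2 \<le> (f (z + t *\<^sub>R (w - z)) - f z) / t"
    using eventually_at_right_real[of 0 "1::real", OF zero_less_one]
  proof eventually_elim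
    case (elim t)
    then have t: "0 < t" "0 \<le> t" "t \<le> 1" by auto
    have "t * (h z - h w + m / 2 * (1 - t) * (norm (w - z))\<^sup>2) \<le> f (z + t *\<^sub>R (w - z)) - f z"
      using strongly_convex_segment[OF conv z w t(2,3)] min[of "z + t *\<^sub>R (w - z)"]
      by (simp add: algebra_simps)
    then show ?case using t by (simp add: field_simps)
  qed
  ultimately have "h z - h w + m / 2 * (1 - 0) * (norm (w - z))\<^sup>2 \<le> g \<bullet> (w - z)"
    by (intro tendsto_le[of "at_right (0::real)"]) auto
  then show ?thesis by simp
qed

lemma strongly_convex_above_tangent:
  fixes f :: "'a::real_inner \<Rightarrow> real"
  assumes "GDERIV f z :> g" and "convex_on UNIV (\<lambda>y. f y - m / 2 * (norm y)\<^sup>2)"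
  shows "f z + g \<bullet> (w - z) + m / 2 * (norm (w - z))\<^sup>2 \<le> f w"
  \<comment> \<open>With \<open>- f\<close> as the smooth part and \<open>f\<close> as the convex
    part the objective is constantly zero, so every point is a minimizer.\<close>
  using variational_inequality[OF GDERIV_minus[OF assms(1)] assms(2), of w] by simp

lemma Lipschitz_gradient_upper_bound:
  fixes f :: "'a::real_inner \<Rightarrow> real"
  assumes g: "\<And>z. GDERIV f z :> g z" and lip: "\<And>z w. norm (g w - g z) \<le> L * norm (w - z)"
  shows "f w \<le> f z + g z \<bullet> (w - z) + L / 2 * (norm (w - z))\<^sup>2"
proof -
  define d where "d = w - z"
  define \<psi> where "\<psi> t = f (z + t *\<^sub>R d) - t * (g z \<bullet> d) - L / 2 * t\<^sup>2 * (norm d)\<^sup>2" for t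
  have "\<psi> 1 \<le> \<psi> 0"
  proof (rule DERIV_nonpos_imp_nonincreasing[of 0 1 \<psi>])
    fix t :: real assume t: "0 \<le> t" "t \<le> 1"
    have "(\<psi> has_real_derivative g (z + t *\<^sub>R d) \<bullet> d - g z \<bullet> d - L * t * (norm d)\<^sup>2) (at t)"
      unfolding \<psi>_def by (auto intro!: derivative_eq_intros GDERIV_line g)
    moreover have "(g (z + t *\<^sub>R d) - g z) \<bullet> d \<le> L * norm (t *\<^sub>R d) * norm d"
      using norm_cauchy_schwarz[of "g (z + t *\<^sub>R d) - g z" d] lip[of "z + t *\<^sub>R d" z]
      by (smt (verit) add_diff_cancel_left' mult_right_mono norm_ge_zero)
    ultimately show "\<exists>D. (\<psi> has_real_derivative D) (at t) \<and> D \<le> 0"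
      using t by - (rule exI, rule conjI, assumption, simp add: inner_diff_left power2_eq_square ac_simps)
  qed simp
  then show ?thesis
    by (simp add: \<psi>_def d_def)
qed

text \<open>Baillon--Haddad.\<close>
lemma cocoercive:
  fixes F :: "'a::real_inner \<Rightarrow> real"
  assumes low: "\<And>z w. F z + G z \<bullet> (w - z) \<le> F w"
    and up: "\<And>z w. F w \<le> F z + G z \<bullet> (w - z) + L / 2 * (norm (w - z))\<^sup>2" and L: "0 \<le> L"
  shows "(norm (G u - G v))\<^sup>2 \<le> L * ((G u - G v) \<bullet> (u - v))"
proof -
  \<comment> \<open>At \<open>u - a *\<^sub>R (G u - G v)\<close> the tangent at \<open>v\<close>
    bounds \<open>F\<close> from below and smoothness around \<open>u\<close> bounds it from above.
    Adding the version with \<open>u\<close> and \<open>v\<close> exchanged eliminates the values of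
    \<open>F\<close>; \<open>a = 1 / L\<close> is the best choice.\<close>
  have half: "F v + G v \<bullet> (u - v) + a * (1 - L * a / 2) * (norm (G u - G v))\<^sup>2 \<le> F u" for u v and a :: real
    using low[of v "u - a *\<^sub>R (G u - G v)"] up[of "u - a *\<^sub>R (G u - G v)" u]
    unfolding power2_norm_eq_inner
    by (simp add: inner_simps inner_commute algebra_simps power2_eq_square)
  have key: "2 * a * (1 - L * a / 2) * (norm (G u - G v))\<^sup>2 \<le> (G u - G v) \<bullet> (u - v)" for a
    using half[of v u a] half[of u v a]
    by (simp add: inner_simps inner_commute algebra_simps norm_minus_commute)
  show ?thesis
  proof (cases "L = 0")
    case True
    have "(norm (G u - G v))\<^sup>2 = 0"
    proof (rule ccontr)
      assume "(norm (G u - G v))\<^sup>2 \<noteq> 0"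
      then have pos: "0 < (norm (G u - G v))\<^sup>2" by simp
      \<comment> \<open>For \<open>L = 0\<close> the inequality \<open>key\<close> is linear in
        \<open>a\<close>; this \<open>a\<close> makes its left side exceed the right side by
        one.\<close>
      from key[of "((G u - G v) \<bullet> (u - v) + 1) / (2 * (norm (G u - G v))\<^sup>2)"] pos True
      show False by simp
    qed
    then show ?thesis using True by simp
  next
    case False
    then show ?thesis using key[of "1 / L"] L by (simp add: field_simps)
  qed
qed

text \<open>Removing \<open>m / 2 * (norm z)\<^sup>2\<close> leaves a convex function with
  smoothness constant \<open>L - m\<close>, whose gradient is cocoercive. The difference of the
  steps is \<open>(1 - \<eta> * m) *\<^sub>R (u - v) - \<eta> *\<^sub>R d\<close>, and its cross
  term absorbs the square of \<open>\<eta> *\<^sub>R d\<close>.\<close>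

lemma gradient_step_contraction:
  fixes f :: "'a::real_inner \<Rightarrow> real"
  assumes g: "\<And>z. GDERIV f z :> g z" and lip: "\<And>z w. norm (g w - g z) \<le> L * norm (w - z)"
    and conv: "convex_on UNIV (\<lambda>y. f y - m / 2 * (norm y)\<^sup>2)"
    and m: "0 \<le> m" "m \<le> L" and \<eta>: "0 \<le> \<eta>" "\<eta> * L \<le> 1"
  shows "norm ((u - \<eta> *\<^sub>R g u) - (v - \<eta> *\<^sub>R g v)) \<le> (1 - \<eta> * m) * norm (u - v)"
proof -
  define F where "F z = f z - m / 2 * (norm z)\<^sup>2" for z
  define G where "G z = g z - m *\<^sub>R z" for z
  define d where "d = G u - G v"
  have norm_sq: "m / 2 * (norm w)\<^sup>2 = m / 2 * (norm z)\<^sup>2 + m * (z \<bullet> (w - z)) + m / 2 * (norm (w - z))\<^sup>2" for w z :: 'a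
    unfolding power2_norm_eq_inner by (simp add: inner_simps inner_commute algebra_simps)
  have coc: "(norm d)\<^sup>2 \<le> (L - m) * (d \<bullet> (u - v))"
    unfolding d_def
  proof (rule cocoercive[where F = F])
    fix z w
    show "F z + G z \<bullet> (w - z) \<le> F w"
      using strongly_convex_above_tangent[OF g conv, of z w] norm_sq[of w z]
      by (simp add: F_def G_def inner_diff_left left_diff_distrib diff_divide_distrib add_divide_distrib)
    show "F w \<le> F z + G z \<bullet> (w - z) + (L - m) / 2 * (norm (w - z))\<^sup>2"
      using Lipschitz_gradient_upper_bound[OF g lip, of w z] norm_sq[of w z]
      by (simp add: F_def G_def inner_diff_left left_diff_distrib diff_divide_distrib add_divide_distrib)
  qed (use m in simp)
  have "0 \<le> d \<bullet> (u - v)"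
    using strongly_convex_above_tangent[OF g conv, of u v] strongly_convex_above_tangent[OF g conv, of v u]
      norm_sq[of u v] norm_sq[of v u]
    by (simp add: d_def G_def inner_simps inner_commute algebra_simps)
  have "\<eta> * m \<le> \<eta> * L" using m \<eta> by (intro mult_left_mono) auto
  then have q: "0 \<le> 1 - \<eta> * m" using \<eta> by simp
  have "\<eta> * (norm d)\<^sup>2 \<le> \<eta> * ((L - m) * (d \<bullet> (u - v)))"
    using coc \<eta> by (intro mult_left_mono)
  also have "\<dots> \<le> 2 * (1 - \<eta> * m) * (d \<bullet> (u - v))"
    unfolding mult.assoc[symmetric]
  proof (rule mult_right_mono)
    show "\<eta> * (L - m) \<le> 2 * (1 - \<eta> * m)"
      using q \<eta> by (simp add: algebra_simps)
  qed fact
  finally have *: "\<eta> * (\<eta> * (norm d)\<^sup>2) \<le> \<eta> * (2 * (1 - \<eta> * m) * (d \<bullet> (u - v)))"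
    using \<eta> by (intro mult_left_mono)
  have norm_sq_diff: "(norm (p *\<^sub>R w - \<eta> *\<^sub>R d))\<^sup>2
      = (p * norm w)\<^sup>2 - \<eta> * (2 * p * (d \<bullet> w)) + \<eta> * (\<eta> * (norm d)\<^sup>2)" for p w
    unfolding power_mult_distrib power2_norm_eq_inner
    by (simp add: inner_simps inner_commute algebra_simps power2_eq_square)
  have "(u - \<eta> *\<^sub>R g u) - (v - \<eta> *\<^sub>R g v) = (1 - \<eta> * m) *\<^sub>R (u - v) - \<eta> *\<^sub>R d"
    by (simp add: d_def G_def algebra_simps)
  then have "(norm ((u - \<eta> *\<^sub>R g u) - (v - \<eta> *\<^sub>R g v)))\<^sup>2 = ((1 - \<eta> * m) * norm (u - v))\<^sup>2
      - \<eta> * (2 * (1 - \<eta> * m) * (d \<bullet> (u - v))) + \<eta> * (\<eta> * (norm d)\<^sup>2)"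
    using norm_sq_diff[of "1 - \<eta> * m" "u - v"] by simp
  also have "\<dots> \<le> ((1 - \<eta> * m) * norm (u - v))\<^sup>2"
    using * by simp
  finally show ?thesis
    by (rule power2_le_imp_le) (use q in simp)
qed

text \<open>The mixed second difference of \<open>P\<close> treats both arguments alike: the bound
  on \<open>gx\<close>, integrated from \<open>b\<close> to \<open>a\<close>, controls it, and
  letting \<open>w\<close> approach \<open>v\<close> returns a bound on \<open>gy\<close>.\<close>

lemma mixed_Lipschitz_swap:
  fixes P :: "'a::real_inner \<Rightarrow> 'b::real_inner \<Rightarrow> real"
  assumes gx: "\<And>u v. GDERIV (\<lambda>u. P u v) u :> gx u v" and gy: "\<And>u v. GDERIV (P u) v :> gy u v"
    and lip: "\<And>u v w. norm (gx u v - gx u w) \<le> L * norm (v - w)" and L: "0 \<le> L"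
  shows "norm (gy a v - gy b v) \<le> L * norm (a - b)"
proof (rule norm_gradient_le_Lipschitz)
  show "GDERIV (\<lambda>v. P a v - P b v) v :> gy a v - gy b v"
    by (intro GDERIV_diff gy)
  fix w
  define \<psi> where "\<psi> t = (P (b + t *\<^sub>R (a - b)) w - P (b + t *\<^sub>R (a - b)) v) - t * (L * norm (w - v) * norm (a - b))" for t
  have "\<psi> 1 \<le> \<psi> 0"
  proof (rule DERIV_nonpos_imp_nonincreasing[of 0 1 \<psi>])
    fix t :: real
    let ?c = "b + t *\<^sub>R (a - b)"
    have "(\<psi> has_real_derivative gx ?c w \<bullet> (a - b) - gx ?c v \<bullet> (a - b) - L * norm (w - v) * norm (a - b)) (at t)"
      unfolding \<psi>_def
      by (auto intro!: derivative_eq_intros GDERIV_line[where f = "\<lambda>u. P u w"] GDERIV_line[where f = "\<lambda>u. P u v"] gx)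
    moreover have "(gx ?c w - gx ?c v) \<bullet> (a - b) \<le> L * norm (w - v) * norm (a - b)"
      using norm_cauchy_schwarz[of "gx ?c w - gx ?c v" "a - b"] lip[of ?c w v]
      by (smt (verit) mult_right_mono norm_ge_zero)
    ultimately show "\<exists>D. (\<psi> has_real_derivative D) (at t) \<and> D \<le> 0"
      by - (rule exI, rule conjI, assumption, simp add: inner_diff_left)
  qed simp
  then show "(P a w - P b w) - (P a v - P b v) \<le> L * norm (a - b) * norm (w - v)"
    by (simp add: \<psi>_def ac_simps)
qed (use L in simp)

section \<open>Attainment of minima for lower semicontinuous functions\<close>

lemma closed_sublevel_add_continuous:
  fixes f g :: "'a::metric_space \<Rightarrow> real"
  assumes f: "\<And>c. closed {y \<in> S. f y \<le> c}" and g: "continuous_on UNIV g"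
  shows "closed {y \<in> S. f y + g y \<le> c}"
  unfolding closed_sequential_limits
proof (intro allI impI, elim conjE)
  fix s l assume s: "\<forall>n. s n \<in> {y \<in> S. f y + g y \<le> c}" and lim: "s \<longlonglongrightarrow> l"
  have lim': "(\<lambda>n. c - g (s n)) \<longlonglongrightarrow> c - g l"
    using g lim by (intro tendsto_intros) (auto simp: continuous_on_eq_continuous_at isCont_tendsto_compose)
  \<comment> \<open>The values \<open>g (s n)\<close> only converge to \<open>g l\<close>, so the
    sublevel of \<open>f\<close> is enlarged by \<open>e\<close>. The case \<open>e = 1\<close>
    gives membership in \<open>S\<close>, arbitrary \<open>e\<close> the inequality.\<close>
  have "l \<in> {y \<in> S. f y \<le> c - g l + e}" if "0 < e" for e
  proof (rule Lim_in_closed_set[OF f _ _ lim])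
    have "\<forall>\<^sub>F n in sequentially. c - g (s n) < c - g l + e"
      using that by (intro order_tendstoD(2)[OF lim']) auto
    then show "\<forall>\<^sub>F n in sequentially. s n \<in> {y \<in> S. f y \<le> c - g l + e}"
    proof eventually_elim
      case (elim n)
      with s[rule_format, of n] show ?case by auto
    qed
  qed simp
  from this[of 1] this show "l \<in> {y \<in> S. f y + g y \<le> c}"
    using field_le_epsilon[of "f l" "c - g l"] by fastforce
qed

text \<open>Sublevel sets at attained values are nested, so finitely many of them have a common
  point in \<open>K\<close>; by compactness all of them do, and such a point is a minimizer.\<close>

lemma lsc_attains_min_on_compact:
  fixes f :: "'a::heine_borel \<Rightarrow> real"
  assumes f: "\<And>c. closed {y \<in> S. f y \<le> c}" and K: "compact K" "S \<inter> K \<noteq> {}"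
  shows "\<exists>z \<in> S \<inter> K. \<forall>w \<in> S \<inter> K. f z \<le> f w"
proof -
  let ?C = "\<lambda>a. {y \<in> S. f y \<le> f a}"
  have "K \<inter> (\<Inter>a \<in> S \<inter> K. ?C a) \<noteq> {}"
  proof (rule compact_imp_fip_image[OF K(1)])
    fix I assume I: "finite I" "I \<subseteq> S \<inter> K"
    show "K \<inter> (\<Inter>a \<in> I. ?C a) \<noteq> {}"
    proof (cases "I = {}")
      case True
      then show ?thesis using K by auto
    next
      case False
      then obtain a where "a \<in> I" "\<And>b. b \<in> I \<Longrightarrow> f a \<le> f b"
        using I(1) ex_min_if_finite[of "f ` I"]
        by (metis arg_min_least arg_min_if_finite(1))
      then show ?thesis using I by blast
    qed
  qed (rule f)
  then show ?thesis using K by blast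
qed

lemma strongly_convex_attains_min:
  fixes f :: "'a::euclidean_space \<Rightarrow> real"
  assumes conv: "convex_on S (\<lambda>y. f y - m / 2 * (norm y)\<^sup>2)" and m: "0 < m"
    and cl: "\<And>c. closed {y \<in> S. f y \<le> c}" and S: "S \<noteq> {}"
  shows "\<exists>z \<in> S. \<forall>w \<in> S. f z \<le> f w"
proof -
  obtain a where a: "a \<in> S" using S by blast
  obtain b where b: "b \<in> S" "\<And>w. \<lbrakk>w \<in> S; w \<in> cball a 1\<rbrakk> \<Longrightarrow> f b \<le> f w"
    using lsc_attains_min_on_compact[OF cl, of "cball a 1"] a by fastforce
  have ba: "f b \<le> f a" using b(2)[OF a] by simp
  \<comment> \<open>\<open>f b\<close> bounds \<open>f\<close> from below on the unit ball around
    \<open>a\<close>. The radius satisfies \<open>m * (R - 1) = 2 * (f a - f b)\<close>, so beyond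
    it the quadratic gain outweighs any linear decrease from \<open>a\<close>.\<close>
  define R where "R = 1 + 2 * (f a - f b) / m"
  have R: "1 \<le> R" using ba m by (simp add: R_def)
  obtain z where z: "z \<in> S" "z \<in> cball a R" "\<And>w. \<lbrakk>w \<in> S; w \<in> cball a R\<rbrakk> \<Longrightarrow> f z \<le> f w"
    using lsc_attains_min_on_compact[OF cl, of "cball a R"] a R by fastforce
  have "f z \<le> f w" if w: "w \<in> S" for w
  proof (cases "w \<in> cball a R")
    case False
    define r where "r = norm (w - a)"
    have r: "R < r" using False by (simp add: r_def dist_norm norm_minus_commute)
    \<comment> \<open>The segment from \<open>a\<close> to \<open>w\<close> leaves the unit ball at
      \<open>p\<close>, hence \<open>f b \<le> f p\<close>; strong convexity then forces
      \<open>f a \<le> f w\<close>.\<close>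
    define p where "p = a + (1 / r) *\<^sub>R (w - a)"
    have p: "p \<in> S" "f p + m / 2 * ((1 / r) * (1 - 1 / r)) * r\<^sup>2 \<le> (1 - 1 / r) * f a + (1 / r) * f w"
      using strongly_convex_segment[OF conv a w, of "1 / r"] r R by (simp_all add: p_def flip: r_def)
    have "p \<in> cball a 1"
      using r R by (auto simp: p_def dist_norm r_def)
    then have "f b + m / 2 * ((1 / r) * (1 - 1 / r)) * r\<^sup>2 \<le> (1 - 1 / r) * f a + (1 / r) * f w"
      using b(2)[OF p(1)] p(2) by simp
    then have "r * (f b + m / 2 * ((1 / r) * (1 - 1 / r)) * r\<^sup>2) \<le> r * ((1 - 1 / r) * f a + (1 / r) * f w)"
      using r R by (intro mult_left_mono) auto
    moreover have "r * (f b + m / 2 * ((1 / r) * (1 - 1 / r)) * r\<^sup>2) = r * f b + m / 2 * (r - 1) * r"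
      using r R by (simp add: field_simps power2_eq_square)
    moreover have "r * ((1 - 1 / r) * f a + (1 / r) * f w) = (r - 1) * f a + f w"
      using r R by (simp add: field_simps)
    ultimately have "r * f b + m / 2 * (r - 1) * r \<le> (r - 1) * f a + f w"
      by simp
    moreover have "2 * (f a - f b) \<le> m * (r - 1)"
      using r m by (simp add: R_def field_simps)
    then have "r * (2 * (f a - f b)) \<le> r * (m * (r - 1))"
      using r R by (intro mult_left_mono) auto
    ultimately have "f a \<le> f w"
      by (simp add: algebra_simps add_divide_distrib diff_divide_distrib)
    then show ?thesis using z(3)[OF a] R by simp
  qed (use z w in blast)
  then show ?thesis using z(1) by blast
qed

section \<open>Proximal points\<close>

lemma GDERIV_unique:
  fixes f :: "'a::euclidean_space \<Rightarrow> real"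
  assumes "GDERIV f z :> D" and "GDERIV f z :> E"
  shows "D = E"
proof -
  have "(\<lambda>h. h \<bullet> D) = (\<lambda>h. h \<bullet> E)"
    using assms unfolding gderiv_def by (rule has_derivative_unique)
  then have "\<forall>h. h \<bullet> D = h \<bullet> E" by (simp add: fun_eq_iff)
  then show ?thesis by (simp only: vector_eq_ldot)
qed

lemma gradient_eqI:
  fixes f :: "'a::euclidean_space \<Rightarrow> real"
  assumes "GDERIV f z :> D"
  shows "gradient f z = D"
  unfolding gradient_def using assms GDERIV_unique by (intro the_equality)

lemma GDERIV_gradient:
  fixes f :: "'a::euclidean_space \<Rightarrow> real"
  assumes "f differentiable (at z)"
  shows "GDERIV f z :> gradient f z"
proof -
  obtain f' where f': "(f has_derivative f') (at z)"
    using assms by (auto simp: differentiable_def)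
  interpret f': bounded_linear f' using f' by (rule has_derivative_bounded_linear)
  define G where "G = (\<Sum>b\<in>Basis. f' b *\<^sub>R b)"
  have "f' d = d \<bullet> G" for d
  proof -
    have "f' d = f' (\<Sum>b\<in>Basis. (d \<bullet> b) *\<^sub>R b)" by (simp add: euclidean_representation)
    also have "\<dots> = d \<bullet> G"
      by (simp add: G_def f'.sum f'.scaleR inner_sum_right mult.commute)
    finally show ?thesis .
  qed
  then have "f' = (\<lambda>d. d \<bullet> G)" by blast
  with f' have "GDERIV f z :> G"
    by (simp only: gderiv_def)
  then show ?thesis by (simp add: gradient_eqI)
qed

lemma convex_on_eqI:
  assumes "convex_on S f" and "\<And>x. x \<in> S \<Longrightarrow> f x = g x"
  shows "convex_on S g"
  unfolding convex_on_def
proof (intro conjI ballI allI impI)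
  show "convex S" using assms(1) by (rule convex_on_imp_convex)
  fix x y and u v :: real
  assume xy: "x \<in> S" "y \<in> S" "0 \<le> u" "0 \<le> v" "u + v = 1"
  then have "u *\<^sub>R x + v *\<^sub>R y \<in> S" using \<open>convex S\<close> by (simp add: convexD)
  then show "g (u *\<^sub>R x + v *\<^sub>R y) \<le> u * g x + v * g y"
    using assms(1) xy by (simp add: convex_on_def flip: assms(2))
qed

text \<open>The finiteness domain is convex because a finite right-hand side forces a finite
  left-hand side.\<close>

lemma ereal_convex_imp_convex_on:
  fixes g :: "'a::real_vector \<Rightarrow> ereal"
  assumes "ereal_convex g" and ninf: "\<And>x. g x \<noteq> -\<infinity>"
  shows "convex_on {x. g x \<noteq> \<infinity>} (\<lambda>x. real_of_ereal (g x))"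
proof -
  have *: "g (u *\<^sub>R x + v *\<^sub>R y) \<noteq> \<infinity> \<and>
      real_of_ereal (g (u *\<^sub>R x + v *\<^sub>R y)) \<le> u * real_of_ereal (g x) + v * real_of_ereal (g y)"
    if fin: "g x \<noteq> \<infinity>" "g y \<noteq> \<infinity>" and uv: "0 \<le> u" "0 \<le> v" "u + v = 1" for x y and u v :: real
  proof -
    obtain a where a: "g x = ereal a" using fin ninf[of x] by (cases "g x") auto
    obtain b where b: "g y = ereal b" using fin ninf[of y] by (cases "g y") auto
    have "g (u *\<^sub>R x + v *\<^sub>R y) \<le> ereal u * g x + ereal v * g y"
      using assms(1) uv by (simp add: ereal_convex_def)
    then show ?thesis
      using ninf[of "u *\<^sub>R x + v *\<^sub>R y"] by (cases "g (u *\<^sub>R x + v *\<^sub>R y)") (simp_all add: a b)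
  qed
  show ?thesis
    unfolding convex_on_def by (auto simp: * intro!: convexI)
qed

lemma ereal_strongly_convex_imp_convex_on:
  fixes g :: "'a::real_inner \<Rightarrow> ereal"
  assumes "ereal_strongly_convex m g" and ninf: "\<And>x. g x \<noteq> -\<infinity>"
  shows "convex_on {x. g x \<noteq> \<infinity>} (\<lambda>x. real_of_ereal (g x) - m / 2 * (norm x)\<^sup>2)"
proof -
  let ?g = "\<lambda>x. g x - ereal (m / 2 * (norm x)\<^sup>2)"
  have fin: "?g x \<noteq> -\<infinity>" "?g x \<noteq> \<infinity> \<longleftrightarrow> g x \<noteq> \<infinity>"
    "g x \<noteq> \<infinity> \<Longrightarrow> real_of_ereal (?g x) = real_of_ereal (g x) - m / 2 * (norm x)\<^sup>2" for x
    using ninf[of x] by (cases "g x"; simp)+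
  have "convex_on {x. ?g x \<noteq> \<infinity>} (\<lambda>x. real_of_ereal (?g x))"
    using assms fin by (intro ereal_convex_imp_convex_on) (auto simp: ereal_strongly_convex_def)
  then show ?thesis
    unfolding fin(2) by (rule convex_on_eqI) (rule fin(3), simp)
qed

lemma lower_semicontinuous_imp_closed:
  fixes g :: "'a::topological_space \<Rightarrow> ereal"
  assumes "lower_semicontinuous g" and ninf: "\<And>x. g x \<noteq> -\<infinity>"
  shows "closed {x \<in> {x. g x \<noteq> \<infinity>}. real_of_ereal (g x) \<le> c}"
proof -
  have "open {x. ereal c < g x}"
    unfolding open_subopen[of "{x. ereal c < g x}"]
  proof (intro ballI)
    fix x assume "x \<in> {x. ereal c < g x}"
    then have x: "ereal c < g x" by simp
    also have "g x \<le> Liminf (at x) g"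
      using assms(1) by (simp add: lower_semicontinuous_def)
    finally have "\<forall>\<^sub>F y in at x. ereal c < g y"
      by (rule less_LiminfD)
    \<comment> \<open>The filter \<open>at x\<close> omits \<open>x\<close>, so the inequality at
      \<open>x\<close> itself is added to obtain a full neighbourhood.\<close>
    then have "\<forall>\<^sub>F y in nhds x. ereal c < g y"
      using x by (auto simp: eventually_at_filter elim: eventually_mono)
    then show "\<exists>T. open T \<and> x \<in> T \<and> T \<subseteq> {x. ereal c < g x}"
      unfolding eventually_nhds by blast
  qed
  moreover have "{x \<in> {x. g x \<noteq> \<infinity>}. real_of_ereal (g x) \<le> c} = - {x. ereal c < g x}"
  proof (rule set_eqI)
    fix x show "x \<in> {x \<in> {x. g x \<noteq> \<infinity>}. real_of_ereal (g x) \<le> c} \<longleftrightarrow> x \<in> - {x. ereal c < g x}"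
      using ninf[of x] by (cases "g x") auto
  qed
  ultimately show ?thesis by (simp add: closed_def)
qed

text \<open>The proximal objective is strongly convex with modulus \<open>m + 1 / \<eta>\<close>, so
  a minimizer exists and the choice behind \<open>ARG_MIN\<close> is one. A negative
  \<open>m\<close> covers weakly convex functions.\<close>

lemma prox_minimizes:
  fixes g :: "'a::euclidean_space \<Rightarrow> ereal"
  defines "S \<equiv> {x. g x \<noteq> \<infinity>}" and "f \<equiv> \<lambda>x. real_of_ereal (g x)"
  assumes ninf: "\<And>x. g x \<noteq> -\<infinity>" and conv: "convex_on S (\<lambda>x. f x - m / 2 * (norm x)\<^sup>2)"
    and cl: "\<And>c. closed {x \<in> S. f x \<le> c}" and S: "S \<noteq> {}"
    and \<eta>: "0 < \<eta>" "0 < m + 1 / \<eta>"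
  shows "prox \<eta> g v \<in> S"
    and "w \<in> S \<Longrightarrow> f (prox \<eta> g v) + 1 / (2 * \<eta>) * (norm (prox \<eta> g v - v))\<^sup>2
        \<le> f w + 1 / (2 * \<eta>) * (norm (w - v))\<^sup>2"
proof -
  define F where "F w = f w + 1 / (2 * \<eta>) * (norm (w - v))\<^sup>2" for w
  define E where "E w = g w + ereal (1 / (2 * \<eta>) * (norm (w - v))\<^sup>2)" for w
  have E: "E w = (if w \<in> S then ereal (F w) else \<infinity>)" for w
    using ninf[of w] by (cases "g w") (auto simp: E_def F_def S_def f_def)
  have "convex S" using conv by (rule convex_on_imp_convex)
  then have "convex_on S (\<lambda>w. a - b * (w \<bullet> v))" for a b
    by (intro convex_onI) (auto simp: inner_simps algebra_simps)
  \<comment> \<open>The proximal square is \<open>1 / (2 * \<eta>) * (norm w)\<^sup>2\<close> plus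
    an affine function of \<open>w\<close>, which raises the modulus by
    \<open>1 / \<eta>\<close>.\<close>
  from convex_on_add[OF conv this[of "1 / (2 * \<eta>) * (norm v)\<^sup>2" "1 / \<eta>"]]
  have "convex_on S (\<lambda>w. F w - (m + 1 / \<eta>) / 2 * (norm w)\<^sup>2)"
    by (rule convex_on_eqI)
      (use \<eta> in \<open>simp_all add: F_def power2_norm_eq_inner inner_simps inner_commute field_simps\<close>)
  moreover have "closed {w \<in> S. F w \<le> c}" for c
    unfolding F_def by (intro closed_sublevel_add_continuous cl continuous_intros)
  ultimately obtain z where z: "z \<in> S" "\<And>w. w \<in> S \<Longrightarrow> F z \<le> F w"
    using strongly_convex_attains_min[OF _ \<eta>(2)] S by blast
  then have "is_arg_min E (\<lambda>_. True) z"
    by (auto simp: is_arg_min_def E not_less)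
  then have "is_arg_min E (\<lambda>_. True) (prox \<eta> g v)"
    unfolding prox_def arg_min_def E_def[symmetric] by (rule someI)
  then have min: "E (prox \<eta> g v) \<le> E w" for w
    by (auto simp: is_arg_min_def not_less)
  then show p: "prox \<eta> g v \<in> S"
    using min[of z] z(1) by (auto simp: E split: if_splits)
  show "f (prox \<eta> g v) + 1 / (2 * \<eta>) * (norm (prox \<eta> g v - v))\<^sup>2
      \<le> f w + 1 / (2 * \<eta>) * (norm (w - v))\<^sup>2" if "w \<in> S"
    using min[of w] p that by (simp add: E F_def)
qed

lemma prox_stationary:
  fixes f :: "'a::euclidean_space \<Rightarrow> real"
  assumes g: "\<And>u. GDERIV f u :> g u" and weak: "weakly_convex \<rho> f" and \<eta>: "0 < \<eta>" "\<eta> * \<rho> < 1"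
  shows "prox \<eta> (\<lambda>u. ereal (f u)) v = v - \<eta> *\<^sub>R g (prox \<eta> (\<lambda>u. ereal (f u)) v)"
proof -
  let ?p = "prox \<eta> (\<lambda>u. ereal (f u)) v"
  define d where "d = g ?p + (1 / \<eta>) *\<^sub>R (?p - v)"
  have "continuous_on UNIV f"
    using g by (intro continuous_at_imp_continuous_on)
      (auto simp: gderiv_def dest: has_derivative_continuous)
  then have cl: "closed {u. f u \<le> c}" for c
    by (intro closed_Collect_le) auto
  have min: "f ?p + 1 / (2 * \<eta>) * (norm (?p - v))\<^sup>2 \<le> f w + 1 / (2 * \<eta>) * (norm (w - v))\<^sup>2" for w
    using prox_minimizes(2)[of "\<lambda>u. ereal (f u)" "- \<rho>" \<eta> w v] weak cl \<eta>
    by (simp add: weakly_convex_def field_simps)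
  have "GDERIV (\<lambda>w. 1 / (2 * \<eta>) * (norm (w - v))\<^sup>2) ?p :> (1 / \<eta>) *\<^sub>R (?p - v)"
    unfolding gderiv_def power2_norm_eq_inner
    using \<eta> by (auto intro!: derivative_eq_intros simp: inner_commute)
  from GDERIV_add[OF g this]
  have "GDERIV (\<lambda>w. f w + 1 / (2 * \<eta>) * (norm (w - v))\<^sup>2) ?p :> d"
    by (simp add: d_def)
  \<comment> \<open>With zero as the convex part, the test point \<open>?p - d\<close> moves against
    the gradient \<open>d\<close> of the objective and forces \<open>d = 0\<close>.\<close>
  from variational_inequality[OF this, of UNIV "\<lambda>_. 0" 0 "?p - d"] min
  have "d \<bullet> d \<le> 0" by (simp add: convex_on_const)
  then have "d = 0" by (metis inner_ge_zero inner_eq_zero_iff order_antisym)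
  then have "\<eta> *\<^sub>R d = 0" by simp
  then show ?thesis using \<eta> by (simp add: d_def algebra_simps)
qed

section \<open>The maximum function and the descent argument\<close>

text \<open>The modulus is split into \<open>\<mu>1\<close> from \<open>P\<close> and
  \<open>\<mu>2\<close> from \<open>f\<close>, which treats both alternatives of the theorem at
  once. \<open>S\<close> and \<open>f\<close> stand for the finiteness domain and the finite part of
  \<open>h\<close>; one \<open>L\<close> serves both mixed Lipschitz bounds.\<close>

locale strongly_concave_max =
  fixes P :: "'a::euclidean_space \<Rightarrow> 'b::euclidean_space \<Rightarrow> real"
    and S :: "'b set" and f :: "'b \<Rightarrow> real"
    and gx :: "'a \<Rightarrow> 'b \<Rightarrow> 'a" and gy :: "'a \<Rightarrow> 'b \<Rightarrow> 'b"
    and Lxx L Lyy \<mu>1 \<mu>2 \<rho> :: real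
  assumes gx: "GDERIV (\<lambda>u. P u v) u :> gx u v" and gy: "GDERIV (P u) v :> gy u v"
    and concave: "convex_on UNIV (\<lambda>v. - P u v - \<mu>1 / 2 * (norm v)\<^sup>2)"
    and convex: "convex_on S (\<lambda>v. f v - \<mu>2 / 2 * (norm v)\<^sup>2)"
    and weak: "convex_on UNIV (\<lambda>u. P u v - (- \<rho>) / 2 * (norm u)\<^sup>2)"
    and closed: "closed {v \<in> S. f v \<le> c}" and nonempty: "S \<noteq> {}"
    and \<mu>1: "0 \<le> \<mu>1" "\<mu>1 \<le> Lyy" and \<mu>2: "0 \<le> \<mu>2" and \<mu>: "0 < \<mu>1 + \<mu>2" and L: "0 \<le> L"
    and gx_x: "norm (gx u v - gx u' v) \<le> Lxx * norm (u - u')"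
    and gx_y: "norm (gx u v - gx u v') \<le> L * norm (v - v')"
    and gy_x: "norm (gy u v - gy u' v) \<le> L * norm (u - u')"
    and gy_y: "norm (gy u v - gy u v') \<le> Lyy * norm (v - v')"
begin

definition ystar :: "'a \<Rightarrow> 'b" where
  "ystar u = (SOME v. v \<in> S \<and> (\<forall>w\<in>S. P u w - f w \<le> P u v - f v))"

definition phi :: "'a \<Rightarrow> real" where
  "phi u = P u (ystar u) - f (ystar u)"

lemma ystar_in [simp]: "ystar u \<in> S"
  and ystar_max: "w \<in> S \<Longrightarrow> P u w - f w \<le> phi u"
proof -
  have "convex_on S (\<lambda>v. (f v - \<mu>2 / 2 * (norm v)\<^sup>2) + (- P u v - \<mu>1 / 2 * (norm v)\<^sup>2))"
    using convex_on_imp_convex[OF convex]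
    by (intro convex_on_add convex convex_on_subset[OF concave]) auto
  then have "convex_on S (\<lambda>v. (f v + - P u v) - (\<mu>1 + \<mu>2) / 2 * (norm v)\<^sup>2)"
    by (simp add: algebra_simps add_divide_distrib)
  moreover have "continuous_on UNIV (\<lambda>v. - P u v)"
    using gy by (intro continuous_intros continuous_at_imp_continuous_on)
      (auto simp: gderiv_def dest: has_derivative_continuous)
  then have "closed {v \<in> S. f v + - P u v \<le> c}" for c
    by (intro closed_sublevel_add_continuous closed)
  ultimately obtain z where z: "z \<in> S" "\<And>w. w \<in> S \<Longrightarrow> f z + - P u z \<le> f w + - P u w"
    using strongly_convex_attains_min[of S "\<lambda>v. f v + - P u v" "\<mu>1 + \<mu>2"] \<mu> nonempty by blast
  have "\<exists>v. v \<in> S \<and> (\<forall>w\<in>S. P u w - f w \<le> P u v - f v)"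
    using z by (intro exI[of _ z]) (auto simp: algebra_simps)
  from someI_ex[OF this]
  show "ystar u \<in> S" "w \<in> S \<Longrightarrow> P u w - f w \<le> phi u"
    by (auto simp: ystar_def phi_def)
qed

lemma ystar_variational:
  assumes "w \<in> S"
  shows "f (ystar u) + gy u (ystar u) \<bullet> (w - ystar u) + \<mu>2 / 2 * (norm (w - ystar u))\<^sup>2 \<le> f w"
  using variational_inequality[OF GDERIV_minus[OF gy] convex ystar_in assms, of u u] ystar_max[of _ u]
  by (simp add: phi_def algebra_simps)

lemma P_below_tangent:
  "P u w \<le> P u v + gy u v \<bullet> (w - v) - \<mu>1 / 2 * (norm (w - v))\<^sup>2"
  using strongly_convex_above_tangent[OF GDERIV_minus[OF gy] concave, of u v w] by simp

text \<open>\<open>\<mu>1\<close> comes from \<open>P u\<close> lying below its tangent,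
  \<open>\<mu>2\<close> from the variational inequality; the linear terms cancel.\<close>

lemma phi_quadratic_growth:
  assumes "w \<in> S"
  shows "P u w - f w + (\<mu>1 + \<mu>2) / 2 * (norm (w - ystar u))\<^sup>2 \<le> phi u"
  using ystar_variational[OF assms, of u] P_below_tangent[of u w "ystar u"]
  by (simp add: phi_def algebra_simps add_divide_distrib)

text \<open>Adding the optimality conditions of both maximizers and the strong monotonicity of
  \<open>- gy a\<close> leaves only a difference of gradients at the common point
  \<open>ystar b\<close>, to which \<open>gy_x\<close> applies.\<close>

lemma ystar_Lipschitz: "(\<mu>1 + \<mu>2) * norm (ystar a - ystar b) \<le> L * norm (a - b)"
proof (cases "ystar a = ystar b")
  case False
  let ?d = "ystar a - ystar b"
  have "(\<mu>1 + \<mu>2) * (norm ?d)\<^sup>2 \<le> (gy a (ystar b) - gy b (ystar b)) \<bullet> ?d"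
    using ystar_variational[OF ystar_in, of a b] ystar_variational[OF ystar_in, of b a]
      P_below_tangent[of a "ystar a" "ystar b"] P_below_tangent[of a "ystar b" "ystar a"]
    by (simp add: inner_simps norm_minus_commute algebra_simps)
  also have "\<dots> \<le> norm (gy a (ystar b) - gy b (ystar b)) * norm ?d"
    by (rule norm_cauchy_schwarz)
  also have "\<dots> \<le> (L * norm (a - b)) * norm ?d"
    by (intro mult_right_mono gy_x) simp
  finally have "((\<mu>1 + \<mu>2) * norm ?d) * norm ?d \<le> (L * norm (a - b)) * norm ?d"
    by (simp add: power2_eq_square mult.assoc)
  then show ?thesis using False by (simp add: mult_le_cancel_right)
qed (use L in simp)

text \<open>Danskin's argument: \<open>phi w - phi u\<close> lies between the increments of
  \<open>P\<close> at fixed \<open>ystar u\<close> and at fixed \<open>ystar w\<close>. Linearizing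
  costs \<open>Lxx / 2\<close>, and moving the gradient from \<open>ystar w\<close> to
  \<open>ystar u\<close> costs the other summand of \<open>K\<close>.\<close>

lemma phi_gderiv: "GDERIV phi u :> gx u (ystar u)"
proof -
  define K where "K = L * (L / (\<mu>1 + \<mu>2)) + Lxx / 2"
  have bound: "\<bar>phi w - phi u - (w - u) \<bullet> gx u (ystar u)\<bar> \<le> K * (norm (w - u))\<^sup>2" for w
  proof -
    have upper: "P b v \<le> P a v + gx a v \<bullet> (b - a) + Lxx / 2 * (norm (b - a))\<^sup>2" for a b v
      by (rule Lipschitz_gradient_upper_bound[where f = "\<lambda>u. P u v" and g = "\<lambda>u. gx u v"]) (rule gx gx_x)+
    have lower: "P u v + gx u v \<bullet> (w - u) - Lxx / 2 * (norm (w - u))\<^sup>2 \<le> P w v" for v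
      using Lipschitz_gradient_upper_bound[where f = "\<lambda>u. - P u v" and g = "\<lambda>u. - gx u v" and L = Lxx and w = w and z = u]
        gx_x[of _ v] by (simp add: GDERIV_minus gx norm_minus_commute)
    have drift: "norm (ystar w - ystar u) \<le> L / (\<mu>1 + \<mu>2) * norm (w - u)"
      using ystar_Lipschitz[of w u] \<mu> by (simp add: field_simps)
    have "(gx u (ystar w) - gx u (ystar u)) \<bullet> (w - u)
        \<le> norm (gx u (ystar w) - gx u (ystar u)) * norm (w - u)"
      by (rule norm_cauchy_schwarz)
    also have "\<dots> \<le> (L * (L / (\<mu>1 + \<mu>2) * norm (w - u))) * norm (w - u)"
      by (intro mult_right_mono order_trans[OF gx_y] mult_left_mono drift L) simp
    finally have "(gx u (ystar w) - gx u (ystar u)) \<bullet> (w - u) \<le> L * (L / (\<mu>1 + \<mu>2)) * (norm (w - u))\<^sup>2"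
      by (simp add: power2_eq_square)
    moreover have "phi w - phi u \<le> P w (ystar w) - P u (ystar w)"
      using ystar_max[OF ystar_in, of u w] by (simp add: phi_def)
    moreover have "P w (ystar u) - P u (ystar u) \<le> phi w - phi u"
      using ystar_max[OF ystar_in, of w u] by (simp add: phi_def)
    moreover have "0 \<le> L * (L / (\<mu>1 + \<mu>2)) * (norm (w - u))\<^sup>2"
      using L \<mu> by (intro mult_nonneg_nonneg divide_nonneg_pos) auto
    ultimately show ?thesis
      using upper[of w "ystar w" u] lower[of "ystar u"]
      unfolding inner_commute[of "w - u"]
      by (simp add: K_def abs_le_iff inner_diff_left distrib_right)
  qed
  have lim: "((\<lambda>w. K * norm (w - u)) \<longlongrightarrow> 0) (at u)"
    by (rule tendsto_eq_intros refl | simp)+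
  show ?thesis
    unfolding gderiv_def has_derivative_iff_norm
  proof (intro conjI tendsto_sandwich[OF _ _ tendsto_const lim] always_eventually allI)
    show "bounded_linear (\<lambda>h. h \<bullet> gx u (ystar u))" by (rule bounded_linear_inner_left)
    fix w
    show "norm (phi w - phi u - (w - u) \<bullet> gx u (ystar u)) / norm (w - u) \<le> K * norm (w - u)"
      using bound[of w] by (cases "w = u") (simp_all add: divide_le_eq power2_eq_square mult.assoc)
  qed simp
qed

text \<open>The extra quadratic term, absent from weak convexity alone, comes from the growth of
  \<open>P a - f\<close> around its maximizer.\<close>
lemma phi_above_parabola:
  "phi b + gx b (ystar b) \<bullet> (a - b) - \<rho> / 2 * (norm (a - b))\<^sup>2
     + (\<mu>1 + \<mu>2) / 2 * (norm (ystar b - ystar a))\<^sup>2 \<le> phi a"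
  using phi_quadratic_growth[OF ystar_in, of a b] strongly_convex_above_tangent[OF gx weak, of b "ystar b" a]
  by (simp add: phi_def)

text \<open>Testing the optimality of \<open>p\<close> at \<open>ystar u\<close> and that of
  \<open>ystar u\<close> at \<open>p\<close> cancels \<open>f\<close> and leaves the difference of
  two explicit gradient steps. The resulting factor
  \<open>(1 - \<eta> * \<mu>1) / (1 + \<eta> * \<mu>2)\<close> is at most
  \<open>1 / (1 + \<eta> * (\<mu>1 + \<mu>2))\<close>, however the modulus is split.\<close>

lemma prox_gradient_contraction:
  assumes \<eta>: "0 < \<eta>" "\<eta> * Lyy \<le> 1" and p: "p \<in> S"
    and min: "\<And>w. w \<in> S \<Longrightarrow>
      f p + 1 / (2 * \<eta>) * (norm (p - (v + \<eta> *\<^sub>R gy u v)))\<^sup>2 \<le> f w + 1 / (2 * \<eta>) * (norm (w - (v + \<eta> *\<^sub>R gy u v)))\<^sup>2"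
  shows "(1 + \<eta> * (\<mu>1 + \<mu>2)) * norm (p - ystar u) \<le> norm (v - ystar u)"
proof -
  define c where "c = v + \<eta> *\<^sub>R gy u v"
  define z where "z = ystar u"
  define d where "d = p - z"
  have "GDERIV (\<lambda>w. 1 / (2 * \<eta>) * (norm (w - c))\<^sup>2) p :> (1 / \<eta>) *\<^sub>R (p - c)"
    unfolding gderiv_def power2_norm_eq_inner
    using \<eta> by (auto intro!: derivative_eq_intros simp: inner_commute)
  from variational_inequality[OF this convex p, of z] min
  have "f p + \<mu>2 / 2 * (norm (z - p))\<^sup>2 \<le> f z + ((1 / \<eta>) *\<^sub>R (p - c)) \<bullet> (z - p)"
    by (simp add: c_def z_def algebra_simps)
  with ystar_variational[OF p, of u]
  have "\<mu>2 * (norm d)\<^sup>2 \<le> - ((1 / \<eta>) * ((p - c) \<bullet> d)) - gy u z \<bullet> d"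
    by (simp add: d_def z_def inner_simps norm_minus_commute algebra_simps)
  then have "\<eta> * (\<mu>2 * (norm d)\<^sup>2) \<le> \<eta> * (- ((1 / \<eta>) * ((p - c) \<bullet> d)) - gy u z \<bullet> d)"
    using \<eta> by (intro mult_left_mono) auto
  also have "\<dots> = - ((p - c) \<bullet> d) - \<eta> * (gy u z \<bullet> d)"
    using \<eta> by (simp add: field_simps)
  also have "\<dots> = ((v + \<eta> *\<^sub>R gy u v) - (z + \<eta> *\<^sub>R gy u z)) \<bullet> d - (norm d)\<^sup>2"
    by (simp add: c_def d_def power2_norm_eq_inner inner_simps inner_commute algebra_simps)
  also have "\<dots> \<le> norm ((v + \<eta> *\<^sub>R gy u v) - (z + \<eta> *\<^sub>R gy u z)) * norm d - (norm d)\<^sup>2"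
    using norm_cauchy_schwarz by simp
  also have "\<dots> \<le> ((1 - \<eta> * \<mu>1) * norm (v - z)) * norm d - (norm d)\<^sup>2"
  proof -
    have "norm ((v - \<eta> *\<^sub>R (- gy u v)) - (z - \<eta> *\<^sub>R (- gy u z))) \<le> (1 - \<eta> * \<mu>1) * norm (v - z)"
      by (rule gradient_step_contraction[where f = "\<lambda>v. - P u v" and g = "\<lambda>v. - gy u v" and L = Lyy])
        (use gy_y[of u] \<eta> \<mu>1 concave in \<open>auto intro!: GDERIV_minus gy simp: norm_minus_commute\<close>)
    then show ?thesis by (simp add: mult_right_mono)
  qed
  finally have "((1 + \<eta> * \<mu>2) * norm d) * norm d \<le> ((1 - \<eta> * \<mu>1) * norm (v - z)) * norm d"
    by (simp add: power2_eq_square algebra_simps)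
  moreover have a: "0 \<le> 1 - \<eta> * \<mu>1"
    using mult_left_mono[OF \<mu>1(2), of \<eta>] \<eta> by linarith
  ultimately have step: "(1 + \<eta> * \<mu>2) * norm d \<le> (1 - \<eta> * \<mu>1) * norm (v - z)"
    by (cases "d = 0") (simp_all add: mult_le_cancel_right)
  have pos: "0 < 1 + \<eta> * \<mu>2"
    using \<eta> \<mu>2 by (simp add: add_pos_nonneg)
  have "(1 + \<eta> * \<mu>2) * ((1 + \<eta> * (\<mu>1 + \<mu>2)) * norm d)
      = (1 + \<eta> * (\<mu>1 + \<mu>2)) * ((1 + \<eta> * \<mu>2) * norm d)"
    by simp
  also have "\<dots> \<le> (1 + \<eta> * (\<mu>1 + \<mu>2)) * ((1 - \<eta> * \<mu>1) * norm (v - z))"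
    using \<eta> \<mu> by (intro mult_left_mono step) auto
  also have "\<dots> = ((1 + \<eta> * (\<mu>1 + \<mu>2)) * (1 - \<eta> * \<mu>1)) * norm (v - z)"
    by simp
  also have "\<dots> \<le> (1 + \<eta> * \<mu>2) * norm (v - z)"
  proof (rule mult_right_mono)
    have "0 \<le> (\<eta> * \<mu>1) * (\<eta> * (\<mu>1 + \<mu>2))"
      using \<eta> \<mu> \<mu>1 by simp
    then show "(1 + \<eta> * (\<mu>1 + \<mu>2)) * (1 - \<eta> * \<mu>1) \<le> 1 + \<eta> * \<mu>2"
      by (simp add: algebra_simps)
  qed simp
  finally show ?thesis
    using pos by (simp add: d_def z_def)
qed

lemma gradients_square_summable:
  fixes x :: "nat \<Rightarrow> 'a" and y :: "nat \<Rightarrow> 'b"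
  assumes x: "\<And>k. x (Suc k) = x k - \<eta> *\<^sub>R gx (x (Suc k)) (y k)"
    and y: "\<And>k. (1 + t) * norm (y (Suc k) - ystar (x (Suc k))) \<le> norm (y k - ystar (x (Suc k)))"
    and \<eta>: "0 < \<eta>" "\<eta> * \<rho> \<le> 1" and t: "0 < t"
    and small: "\<eta> * L\<^sup>2 * (2 + t) < t * (\<mu>1 + \<mu>2)"
    and bounded: "\<And>u. B \<le> phi u"
  shows "\<exists>M. \<forall>K. (\<Sum>k<K. (norm (gx (x k) (ystar (x k))))\<^sup>2) \<le> M"
proof -
  define \<mu> where "\<mu> = \<mu>1 + \<mu>2"
  define e where "e k = norm (y k - ystar (x (Suc k)))" for k
  define D where "D k = norm (x (Suc k) - x k)" for k
  define s where "s k = norm (ystar (x (Suc k)) - ystar (x k))" for k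
  define G where "G k = norm (gx (x k) (ystar (x k)))" for k
  \<comment> \<open>\<open>p\<close> and \<open>q\<close> are the coefficients obtained when the
    square of \<open>e k / (1 + t) + s (Suc k)\<close> is split by Young's inequality with weight
    \<open>t\<close>.\<close>
  define p where "p = (1 + t) / t"
  define q where "q = 1 / (1 + t)"
  \<comment> \<open>Half of what remains of the coefficient of \<open>(D k)\<^sup>2\<close>; the
    other half pays for \<open>\<gamma>\<close>. Positivity is exactly the hypothesis
    \<open>small\<close>.\<close>
  define \<sigma> where "\<sigma> = (1 / (2 * \<eta>) - L\<^sup>2 / \<mu> * (p - 1 / 2)) / 2"
  \<comment> \<open>The added 1 keeps the denominator positive when \<open>L = 0\<close>.\<close>
  define \<gamma> where "\<gamma> = \<sigma> / (p\<^sup>2 * (L\<^sup>2 / \<mu>\<^sup>2) + 1)"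
  \<comment> \<open>By \<open>p * (1 - q) = 1\<close> this weight makes the decrease of
    \<open>c * (e k)\<^sup>2\<close> pay for the Young term
    \<open>\<mu> / (2 * p) * (e (Suc k))\<^sup>2\<close> and leave
    \<open>\<gamma> * (e (Suc k))\<^sup>2\<close>, up to a multiple of
    \<open>(s (Suc k))\<^sup>2\<close>.\<close>
  define c where "c = (\<mu> / (2 * p) + \<gamma>) * (p * q)"
  define W where "W k = phi (x (Suc k)) + c * (e k)\<^sup>2" for k
  define N where "N = 2 / (\<eta>\<^sup>2 * \<sigma>) + 2 * L\<^sup>2 / \<gamma>"
  have \<mu>0: "0 < \<mu>" using local.\<mu> by (simp add: \<mu>_def)
  have p: "1 < p" and q: "0 < q" and pq: "p * (1 - q) = 1"
    using t add_pos_pos[OF t mult_pos_pos[OF t t]] by (simp_all add: p_def q_def field_simps)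
  have "\<sigma> = (t * \<mu> - \<eta> * L\<^sup>2 * (2 + t)) / (4 * \<eta> * \<mu> * t)"
    using \<eta> \<mu>0 t by (simp add: \<sigma>_def p_def field_simps)
  then have \<sigma>: "0 < \<sigma>"
    using small \<eta> \<mu>0 t by (simp add: \<mu>_def)
  have den: "0 < p\<^sup>2 * (L\<^sup>2 / \<mu>\<^sup>2) + 1"
    by (intro add_nonneg_pos) auto
  have \<gamma>: "0 < \<gamma>" using \<sigma> den by (simp add: \<gamma>_def)
  have "\<gamma> * (p\<^sup>2 * (L\<^sup>2 / \<mu>\<^sup>2) + 1) = \<sigma>"
    using den by (simp add: \<gamma>_def)
  then have \<gamma>p: "\<gamma> * p\<^sup>2 * (L\<^sup>2 / \<mu>\<^sup>2) \<le> \<sigma>"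
    using \<gamma> by (simp add: algebra_simps)
  have c: "0 \<le> c" using \<gamma> p q \<mu>0 by (simp add: c_def)
  have nonneg: "0 \<le> e k" "0 \<le> D k" "0 \<le> s k" "0 \<le> G k" for k
    by (simp_all add: e_def D_def s_def G_def)
  have s_le: "(s k)\<^sup>2 \<le> L\<^sup>2 / \<mu>\<^sup>2 * (D k)\<^sup>2" for k
  proof -
    have "s k \<le> L / \<mu> * D k"
      using ystar_Lipschitz[of "x (Suc k)" "x k"] \<mu>0 by (simp add: s_def D_def \<mu>_def field_simps)
    from power_mono[OF this nonneg(3), of 2] show ?thesis
      by (simp add: power_mult_distrib power_divide)
  qed
  have e_step: "(e (Suc k))\<^sup>2 \<le> q * (e k)\<^sup>2 + p * (s (Suc k))\<^sup>2" for k
  proof -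
    have "norm (y (Suc k) - ystar (x (Suc (Suc k)))) \<le> norm (y (Suc k) - ystar (x (Suc k))) + s (Suc k)"
      using norm_triangle_ineq4[of "y (Suc k) - ystar (x (Suc k))" "ystar (x (Suc (Suc k))) - ystar (x (Suc k))"]
      by (simp add: s_def)
    moreover have "norm (y (Suc k) - ystar (x (Suc k))) \<le> e k / (1 + t)"
      using y[of k] t by (simp add: e_def field_simps)
    ultimately have "e (Suc k) \<le> e k / (1 + t) + s (Suc k)"
      by (simp add: e_def)
    from power_mono[OF this nonneg(1), of 2]
    have "(e (Suc k))\<^sup>2 \<le> (e k / (1 + t) + s (Suc k))\<^sup>2" .
    also have "\<dots> = q * (e k)\<^sup>2 + p * (s (Suc k))\<^sup>2 - (e k * t / (1 + t) - s (Suc k))\<^sup>2 / t"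
      unfolding q_def p_def using t add_pos_pos[OF zero_less_one t]
      by (simp add: divide_simps power2_eq_square) (simp add: algebra_simps)
    finally show ?thesis using t by (smt (verit) divide_nonneg_pos zero_le_power2)
  qed
  have gap: "norm (gx (x (Suc k)) (ystar (x (Suc k))) - gx (x (Suc k)) (y k)) \<le> L * e k" for k
    using gx_y[of "x (Suc k)" "ystar (x (Suc k))" "y k"] by (simp add: e_def norm_minus_commute)
  \<comment> \<open>The parabola around the new point is evaluated at the old one. Replacing
    \<open>ystar\<close> by \<open>y k\<close> in the gradient costs \<open>L * e k * D k\<close>,
    and \<open>\<eta> * \<rho> \<le> 1\<close> lets half of
    \<open>1 / \<eta> * (D k)\<^sup>2\<close> absorb the weak convexity.\<close>
  have phi_step: "phi (x (Suc k)) + 1 / (2 * \<eta>) * (D k)\<^sup>2 \<le> phi (x k) + L * e k * D k - \<mu> / 2 * (s k)\<^sup>2" for k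
  proof -
    let ?b = "x (Suc k)"
    let ?d = "x k - ?b"
    have "(gx ?b (y k) - gx ?b (ystar ?b)) \<bullet> ?d \<le> norm (gx ?b (y k) - gx ?b (ystar ?b)) * norm ?d"
      by (rule norm_cauchy_schwarz)
    also have "\<dots> \<le> L * e k * norm ?d"
      using gap[of k] by (intro mult_right_mono) (auto simp: norm_minus_commute)
    finally have "(gx ?b (y k) - gx ?b (ystar ?b)) \<bullet> ?d \<le> L * e k * D k"
      by (simp add: D_def norm_minus_commute)
    moreover have "gx ?b (y k) = (1 / \<eta>) *\<^sub>R ?d"
      by (subst x) (use \<eta> in simp)
    then have "gx ?b (y k) \<bullet> ?d = 1 / \<eta> * (D k)\<^sup>2"
      by (simp add: D_def power2_norm_eq_inner[symmetric] norm_minus_commute)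
    ultimately have "1 / \<eta> * (D k)\<^sup>2 - L * e k * D k \<le> gx ?b (ystar ?b) \<bullet> ?d"
      by (simp add: inner_diff_left)
    moreover have "\<rho> * (D k)\<^sup>2 \<le> 1 / \<eta> * (D k)\<^sup>2"
      using \<eta> by (intro mult_right_mono) (auto simp: field_simps)
    moreover have "phi ?b + gx ?b (ystar ?b) \<bullet> ?d - \<rho> / 2 * (D k)\<^sup>2 + \<mu> / 2 * (s k)\<^sup>2 \<le> phi (x k)"
      using phi_above_parabola[of ?b "x k"] by (simp add: D_def s_def \<mu>_def norm_minus_commute)
    ultimately show ?thesis by simp
  qed
  have young: "L * e k * D k \<le> \<mu> / (2 * p) * (e k)\<^sup>2 + L\<^sup>2 * p / (2 * \<mu>) * (D k)\<^sup>2" for k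
  proof -
    have "0 \<le> \<mu> / (2 * p) * (e k - L * p / \<mu> * D k)\<^sup>2"
      using \<mu>0 p by simp
    also have "\<dots> = \<mu> / (2 * p) * (e k)\<^sup>2 + L\<^sup>2 * p / (2 * \<mu>) * (D k)\<^sup>2 - L * e k * D k"
      using \<mu>0 p by (simp add: field_simps power2_eq_square)
    finally show ?thesis by simp
  qed
  have W_step: "\<sigma> * (D (Suc k))\<^sup>2 + \<gamma> * (e (Suc k))\<^sup>2 \<le> W k - W (Suc k)" for k
  proof -
    let ?E = "(e (Suc k))\<^sup>2" and ?F = "(e k)\<^sup>2" and ?s = "(s (Suc k))\<^sup>2" and ?D = "(D (Suc k))\<^sup>2"
    let ?a = "\<mu> / (2 * p) + \<gamma>"
    have "p * ?E \<le> p * (q * ?F + p * ?s)"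
      using e_step[of k] p by (intro mult_left_mono) auto
    moreover have "p * q = p - 1" using pq by (simp add: algebra_simps)
    then have "p * q * ?E = p * ?E - ?E"
      by (simp add: left_diff_distrib)
    ultimately have "?E \<le> p * q * ?F - p * q * ?E + p\<^sup>2 * ?s"
      by (simp add: algebra_simps power2_eq_square)
    then have "?a * ?E \<le> ?a * (p * q * ?F - p * q * ?E + p\<^sup>2 * ?s)"
      using \<mu>0 p \<gamma> by (intro mult_left_mono) auto
    also have "\<dots> = c * ?F - c * ?E + (\<mu> * p / 2 + \<gamma> * p\<^sup>2) * ?s"
      using p by (simp add: c_def field_simps power2_eq_square)
    finally have 1: "\<mu> / (2 * p) * ?E + \<gamma> * ?E \<le> c * ?F - c * ?E + (\<mu> * p / 2 + \<gamma> * p\<^sup>2) * ?s"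
      by (simp add: distrib_right)
    \<comment> \<open>Here the growth term \<open>- \<mu> / 2 * ?s\<close> of
      \<open>phi_step\<close> pays off: it lowers the factor \<open>p\<close> to
      \<open>p - 1\<close>, which stays nonnegative, before \<open>s\<close> is traded for
      \<open>D\<close>.\<close>
    have "(\<mu> * (p - 1) / 2 + \<gamma> * p\<^sup>2) * ?s \<le> (\<mu> * (p - 1) / 2 + \<gamma> * p\<^sup>2) * (L\<^sup>2 / \<mu>\<^sup>2 * ?D)"
      using \<mu>0 p \<gamma> by (intro mult_left_mono s_le) auto
    also have "\<dots> = L\<^sup>2 / \<mu> * (p - 1) / 2 * ?D + \<gamma> * p\<^sup>2 * (L\<^sup>2 / \<mu>\<^sup>2) * ?D"
      using \<mu>0 by (simp add: field_simps power2_eq_square)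
    also have "\<dots> \<le> L\<^sup>2 / \<mu> * (p - 1) / 2 * ?D + \<sigma> * ?D"
      using \<gamma>p by (intro add_left_mono mult_right_mono) auto
    finally have 2: "(\<mu> * p / 2 + \<gamma> * p\<^sup>2) * ?s - \<mu> / 2 * ?s \<le> L\<^sup>2 / \<mu> * (p - 1) / 2 * ?D + \<sigma> * ?D"
      by (simp add: algebra_simps diff_divide_distrib)
    have "1 / (2 * \<eta>) = 2 * \<sigma> + L\<^sup>2 / \<mu> * (p - 1 / 2)"
      unfolding \<sigma>_def by (simp only: times_divide_eq_right nonzero_mult_div_cancel_left)
    also have "L\<^sup>2 / \<mu> * (p - 1 / 2) = L\<^sup>2 * p / (2 * \<mu>) + L\<^sup>2 / \<mu> * (p - 1) / 2"
      using \<mu>0 by (simp add: field_simps)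
    finally have 3: "1 / (2 * \<eta>) * ?D = 2 * \<sigma> * ?D + L\<^sup>2 * p / (2 * \<mu>) * ?D + L\<^sup>2 / \<mu> * (p - 1) / 2 * ?D"
      by (simp only: distrib_right add.assoc)
    show ?thesis
      using 1 2 3 phi_step[of "Suc k"] young[of "Suc k"] by (simp add: W_def)
  qed
  have G_step: "(G (Suc (Suc k)))\<^sup>2 \<le> N * (W k - W (Suc k))" for k
  proof -
    let ?b = "x (Suc (Suc k))"
    have "gx ?b (y (Suc k)) = (1 / \<eta>) *\<^sub>R (x (Suc k) - ?b)"
      by (subst x) (use \<eta> in simp)
    then have "norm (gx ?b (y (Suc k))) = D (Suc k) / \<eta>"
      using \<eta> by (simp add: D_def norm_minus_commute)
    then have "G (Suc (Suc k)) \<le> D (Suc k) / \<eta> + L * e (Suc k)"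
      using norm_triangle_sub[of "gx ?b (ystar ?b)" "gx ?b (y (Suc k))"] gap[of "Suc k"]
      by (simp add: G_def)
    from power_mono[OF this nonneg(4), of 2]
    have "(G (Suc (Suc k)))\<^sup>2 \<le> (D (Suc k) / \<eta> + L * e (Suc k))\<^sup>2" .
    also have "\<dots> \<le> 2 * (D (Suc k) / \<eta>)\<^sup>2 + 2 * (L * e (Suc k))\<^sup>2"
      using zero_le_power2[of "D (Suc k) / \<eta> - L * e (Suc k)"] by (simp add: power2_sum power2_diff)
    also have "\<dots> = 2 / (\<eta>\<^sup>2 * \<sigma>) * (\<sigma> * (D (Suc k))\<^sup>2) + 2 * L\<^sup>2 / \<gamma> * (\<gamma> * (e (Suc k))\<^sup>2)"
      using \<sigma> \<gamma> by (simp add: power_mult_distrib power_divide)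
    also have "\<dots> \<le> N * (\<sigma> * (D (Suc k))\<^sup>2 + \<gamma> * (e (Suc k))\<^sup>2)"
      using \<sigma> \<gamma> by (simp add: N_def algebra_simps)
    also have "\<dots> \<le> N * (W k - W (Suc k))"
      using \<sigma> \<gamma> by (intro mult_left_mono W_step) (simp add: N_def)
    finally show ?thesis .
  qed
  have N: "0 \<le> N" using \<sigma> \<gamma> by (simp add: N_def)
  \<comment> \<open>The descent estimate first controls the gradient at index 2, so the first two
    terms are split off before telescoping.\<close>
  have "(\<Sum>k<K. (G k)\<^sup>2) \<le> (G 0)\<^sup>2 + (G 1)\<^sup>2 + N * (W 0 - B)" for K
  proof -
    have "(\<Sum>k<K. (G k)\<^sup>2) \<le> (\<Sum>k<Suc (Suc K). (G k)\<^sup>2)"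
      by (simp)
    also have "\<dots> = (G 0)\<^sup>2 + (G 1)\<^sup>2 + (\<Sum>k<K. (G (Suc (Suc k)))\<^sup>2)"
      by (simp add: sum.lessThan_Suc_shift del: sum.lessThan_Suc)
    also have "(\<Sum>k<K. (G (Suc (Suc k)))\<^sup>2) \<le> (\<Sum>k<K. N * (W k - W (Suc k)))"
      by (intro sum_mono G_step)
    also have "\<dots> = N * (W 0 - W K)"
      by (simp add: sum_distrib_left[symmetric] sum_lessThan_telescope')
    also have "\<dots> \<le> N * (W 0 - B)"
      using bounded[of "x (Suc K)"] mult_nonneg_nonneg[OF c zero_le_power2[of "e K"]] N
      by (intro mult_left_mono) (simp_all add: W_def)
    finally show ?thesis by simp
  qed
  then show ?thesis by (auto simp: G_def)
qed

end

section \<open>Reduction of the extended-real problem to the locale, and the iteration count\<close>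

theorem theorem4p1:
  fixes \<Phi> :: "(real ^ 'd) \<times> (real ^ 'n) \<Rightarrow> real"
    and h :: "real ^ 'n \<Rightarrow> ereal"
    and Lxx Lxy Lyx Lyy \<mu> \<rho> \<eta>x \<eta>y :: real
    and x :: "nat \<Rightarrow> real ^ 'd" and y :: "nat \<Rightarrow> real ^ 'n"
  assumes "\<forall>z. \<Phi> differentiable (at z)"
    and "proper h" "lower_semicontinuous h" "ereal_convex h"
    and "Lxx > 0" "Lxy > 0" "Lyx > 0" "Lyy > 0" "\<mu> > 0" "\<rho> > 0"
    and "\<forall>u1 u2 v. norm (grad_x \<Phi> u1 v - grad_x \<Phi> u2 v) \<le> Lxx * norm (u1 - u2)"
    and "\<forall>u v1 v2. norm (grad_x \<Phi> u v1 - grad_x \<Phi> u v2) \<le> Lxy * norm (v1 - v2)"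
    and "\<forall>u1 u2 v. norm (grad_y \<Phi> u1 v - grad_y \<Phi> u2 v) \<le> Lyx * norm (u1 - u2)"
    and "\<forall>u v1 v2. norm (grad_y \<Phi> u v1 - grad_y \<Phi> u v2) \<le> Lyy * norm (v1 - v2)"
    and "\<forall>u. concave_on UNIV (\<lambda>v. \<Phi> (u, v))"
    and "(\<forall>u. strongly_concave \<mu> (\<lambda>v. \<Phi> (u, v))) \<or> ereal_strongly_convex \<mu> h"
    and "\<forall>v. weakly_convex \<rho> (\<lambda>u. \<Phi> (u, v))"
    and "(INF u. ereal (max_fun \<Phi> h u)) > -\<infinity>"
    and "Lyy / \<mu> \<ge> 1"
    and "0 < \<eta>y" "\<eta>y \<le> 1 / Lyy"
    and "0 < \<eta>x"
    and "\<eta>x < min (\<eta>y * Lyy * \<mu> / (sqrt 2 * Lxy * Lyx * (sqrt 2 * (Lyy / \<mu>) + \<eta>y * Lyy))) (1 / \<rho>)"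
    and "\<forall>k. x (Suc k) = prox \<eta>x (\<lambda>u. ereal (\<Phi> (u, y k))) (x k)"
    and "\<forall>k. y (Suc k) = prox \<eta>y h (y k + \<eta>y *\<^sub>R grad_y \<Phi> (x (Suc k)) (y k))"
  shows "\<exists>C>0. \<forall>\<epsilon>>0. \<exists>k. real k \<le> C / \<epsilon>\<^sup>2 \<and>
           max_fun \<Phi> h differentiable (at (x k)) \<and>
           norm (gradient (max_fun \<Phi> h) (x k)) < \<epsilon>"
proof -
  note diff = assms(1) and pos = assms(5-10) and lip = assms(11-14) and bounded = assms(18)
    and \<eta>y = assms(20,21) and \<eta>x = assms(22,23) and xstep = assms(24) and ystep = assms(25)
  define S where "S = {v. h v \<noteq> \<infinity>}"
  define f where "f v = real_of_ereal (h v)" for v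
  define L where "L = min Lxy Lyx"
  have ninf: "h v \<noteq> -\<infinity>" for v using assms(2) by (simp add: proper_def)
  have h_S: "h v = ereal (f v)" if "v \<in> S" for v
    using that ninf[of v] by (cases "h v") (auto simp: S_def f_def)
  have f_convex: "convex_on S f"
    unfolding S_def f_def using ereal_convex_imp_convex_on[OF assms(4) ninf] by simp
  have f_closed: "closed {v \<in> S. f v \<le> c}" for c
    unfolding S_def f_def by (rule lower_semicontinuous_imp_closed[OF assms(3) ninf])
  have S: "S \<noteq> {}" using assms(2) by (auto simp: proper_def S_def)
  have gx: "GDERIV (\<lambda>u. \<Phi> (u, v)) u :> grad_x \<Phi> u v" for u v
  proof -
    have "((\<lambda>u. (u, v)) has_derivative (\<lambda>d. (d, 0))) (at u)"
      by (auto intro!: derivative_eq_intros)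
    moreover obtain D where "(\<Phi> has_derivative D) (at (u, v))"
      using diff unfolding differentiable_def by blast
    ultimately have "((\<lambda>u. \<Phi> (u, v)) has_derivative (\<lambda>d. D (d, 0))) (at u)"
      by (rule has_derivative_compose)
    then show ?thesis
      unfolding grad_x_def by (intro GDERIV_gradient) (auto simp: differentiable_def)
  qed
  have gy: "GDERIV (\<lambda>v. \<Phi> (u, v)) v :> grad_y \<Phi> u v" for u v
  proof -
    have "((\<lambda>v. (u, v)) has_derivative (\<lambda>d. (0, d))) (at v)"
      by (auto intro!: derivative_eq_intros)
    moreover obtain D where "(\<Phi> has_derivative D) (at (u, v))"
      using diff unfolding differentiable_def by blast
    ultimately have "((\<lambda>v. \<Phi> (u, v)) has_derivative (\<lambda>d. D (0, d))) (at v)"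
      by (rule has_derivative_compose)
    then show ?thesis
      unfolding grad_y_def by (intro GDERIV_gradient) (auto simp: differentiable_def)
  qed
  \<comment> \<open>The smaller of the two mixed constants bounds one gradient by hypothesis and the
    other by \<open>mixed_Lipschitz_swap\<close>.\<close>
  have gx_y: "norm (grad_x \<Phi> u v - grad_x \<Phi> u w) \<le> L * norm (v - w)" for u v w
    using lip(2) mixed_Lipschitz_swap[where P = "\<lambda>v u. \<Phi> (u, v)" and gx = "\<lambda>v u. grad_y \<Phi> u v"
        and gy = "\<lambda>v u. grad_x \<Phi> u v" and L = Lyx, OF gy gx] lip(3) pos
    by (auto simp: L_def min_def)
  have gy_x: "norm (grad_y \<Phi> u v - grad_y \<Phi> w v) \<le> L * norm (u - w)" for u v w
    using lip(3) mixed_Lipschitz_swap[where P = "\<lambda>u v. \<Phi> (u, v)" and gx = "grad_x \<Phi>"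
        and gy = "grad_y \<Phi>" and L = Lxy, OF gx gy] lip(2) pos
    by (auto simp: L_def min_def)
  have "\<mu> \<le> Lyy" using assms(19) pos by (simp add: field_simps)
  \<comment> \<open>The pair is \<open>(\<mu>, 0)\<close> if \<Phi> is strongly concave in its
    second argument, and \<open>(0, \<mu>)\<close> if \<open>h\<close> is strongly convex.\<close>
  obtain \<mu>1 \<mu>2 where \<mu>12: "0 \<le> \<mu>1" "\<mu>1 \<le> Lyy" "0 \<le> \<mu>2" "\<mu>1 + \<mu>2 = \<mu>"
    "\<And>u. convex_on UNIV (\<lambda>v. - \<Phi> (u, v) - \<mu>1 / 2 * (norm v)\<^sup>2)"
    "convex_on S (\<lambda>v. f v - \<mu>2 / 2 * (norm v)\<^sup>2)"
  proof (cases "\<forall>u. strongly_concave \<mu> (\<lambda>v. \<Phi> (u, v))")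
    case True
    then show ?thesis
      using that[of \<mu> 0] pos \<open>\<mu> \<le> Lyy\<close> f_convex by (simp add: strongly_concave_def)
  next
    case False
    then have "convex_on S (\<lambda>v. f v - \<mu> / 2 * (norm v)\<^sup>2)"
      unfolding S_def f_def using assms(16) by (intro ereal_strongly_convex_imp_convex_on ninf) auto
    then show ?thesis
      using that[of 0 \<mu>] pos assms(15) by (simp add: concave_on_def)
  qed
  interpret strongly_concave_max "\<lambda>u v. \<Phi> (u, v)" S f "grad_x \<Phi>" "grad_y \<Phi>" Lxx L Lyy \<mu>1 \<mu>2 \<rho>
  proof unfold_locales
    show "convex_on UNIV (\<lambda>u. \<Phi> (u, v) - (- \<rho>) / 2 * (norm u)\<^sup>2)" for v
      using assms(17) by (simp add: weakly_convex_def)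
  qed (rule gx gy \<mu>12 f_closed S gx_y gy_x lip(1)[rule_format] lip(4)[rule_format]
      | simp add: L_def \<mu>12(4) pos less_imp_le)+
  have "max_fun \<Phi> h u = phi u" for u
  proof -
    have "(GREATEST m. m \<in> range (\<lambda>v. ereal (\<Phi> (u, v)) - h v)) = ereal (phi u)"
    proof (rule Greatest_equality)
      show "ereal (phi u) \<in> range (\<lambda>v. ereal (\<Phi> (u, v)) - h v)"
        by (rule range_eqI[of _ _ "ystar u"]) (simp add: phi_def h_S)
      fix m assume "m \<in> range (\<lambda>v. ereal (\<Phi> (u, v)) - h v)"
      then obtain v where m: "m = ereal (\<Phi> (u, v)) - h v" by blast
      show "m \<le> ereal (phi u)"
      proof (cases "v \<in> S")
        case True
        then show ?thesis using ystar_max[OF True, of u] by (simp add: m h_S)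
      qed (simp add: m S_def)
    qed
    then show ?thesis by (simp add: max_fun_def)
  qed
  then have max_fun: "max_fun \<Phi> h = phi" by blast
  obtain B where "ereal B < (INF u. ereal (max_fun \<Phi> h u))"
    using bounded ereal_dense2 by blast
  then have B: "B \<le> phi u" for u
    using less_INF_D[of "ereal B" "\<lambda>u. ereal (max_fun \<Phi> h u)" UNIV u] by (simp add: max_fun)
  have \<eta>y_Lyy: "\<eta>y * Lyy \<le> 1" using \<eta>y pos by (simp add: field_simps)
  have "\<eta>x * \<rho> < 1" using \<eta>x pos by (simp add: field_simps)
  have small: "\<eta>x * L\<^sup>2 * (2 + \<eta>y * \<mu>) < (\<eta>y * \<mu>) * (\<mu>1 + \<mu>2)"
  proof -
    \<comment> \<open>Cancelling \<open>Lyy / \<mu>\<close> turns the step-size bound into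
      \<open>\<eta>x * Q < \<eta>y * \<mu> * \<mu>\<close>. The claim follows from
      \<open>L\<^sup>2 \<le> Lxy * Lyx\<close> and \<open>1 \<le> sqrt 2\<close>.\<close>
    define Q where "Q = Lxy * Lyx * (2 + sqrt 2 * (\<eta>y * \<mu>))"
    have "sqrt 2 * Lxy * Lyx * (sqrt 2 * (Lyy / \<mu>) + \<eta>y * Lyy) = Lyy / \<mu> * Q"
      using pos by (simp add: Q_def field_simps)
    then have "\<eta>x < \<eta>y * Lyy * \<mu> / (Lyy / \<mu> * Q)"
      using \<eta>x by simp
    also have "\<dots> = \<eta>y * \<mu> * \<mu> / Q"
      using pos by simp
    moreover have "0 < Q"
      unfolding Q_def using pos \<eta>y by (intro mult_pos_pos add_pos_pos) auto
    ultimately have "\<eta>x * (Lxy * Lyx * (2 + sqrt 2 * (\<eta>y * \<mu>))) < \<eta>y * \<mu> * \<mu>"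
      by (simp add: pos_less_divide_eq flip: Q_def)
    moreover have "L\<^sup>2 * (2 + \<eta>y * \<mu>) \<le> (Lxy * Lyx) * (2 + sqrt 2 * (\<eta>y * \<mu>))"
    proof (rule mult_mono)
      show "L\<^sup>2 \<le> Lxy * Lyx"
        unfolding power2_eq_square using pos by (intro mult_mono) (auto simp: L_def)
      show "2 + \<eta>y * \<mu> \<le> 2 + sqrt 2 * (\<eta>y * \<mu>)"
        using mult_right_mono[of 1 "sqrt 2" "\<eta>y * \<mu>"] \<eta>y pos by simp
    qed (use pos \<eta>y in auto)
    then have "\<eta>x * (L\<^sup>2 * (2 + \<eta>y * \<mu>)) \<le> \<eta>x * ((Lxy * Lyx) * (2 + sqrt 2 * (\<eta>y * \<mu>)))"
      using \<eta>x by (intro mult_left_mono) auto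
    ultimately show ?thesis by (simp add: \<mu>12 mult.assoc)
  qed
  have "x (Suc k) = x k - \<eta>x *\<^sub>R grad_x \<Phi> (x (Suc k)) (y k)" for k
    unfolding xstep[rule_format]
    by (rule prox_stationary) (use gx assms(17) \<eta>x \<open>\<eta>x * \<rho> < 1\<close> in auto)
  moreover have "(1 + \<eta>y * \<mu>) * norm (y (Suc k) - ystar (x (Suc k))) \<le> norm (y k - ystar (x (Suc k)))" for k
  proof -
    note p = prox_minimizes[of h 0 \<eta>y, folded S_def, folded f_def, OF ninf _ f_closed S]
    have "(1 + \<eta>y * (\<mu>1 + \<mu>2)) * norm (y (Suc k) - ystar (x (Suc k))) \<le> norm (y k - ystar (x (Suc k)))"
      using \<eta>y \<eta>y_Lyy f_convex unfolding ystep[rule_format, of k]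
      by (intro prox_gradient_contraction p) auto
    then show ?thesis by (simp add: \<mu>12)
  qed
  ultimately obtain M where M: "\<And>K. (\<Sum>k<K. (norm (grad_x \<Phi> (x k) (ystar (x k))))\<^sup>2) \<le> M"
    using gradients_square_summable[of x \<eta>x y "\<eta>y * \<mu>" B] small B \<eta>x \<eta>y pos \<open>\<eta>x * \<rho> < 1\<close> by auto
  have M0: "0 \<le> M" using M[of 0] by simp
  show ?thesis
  proof (intro exI[of _ "M + 1"] conjI allI impI)
    show "0 < M + 1" using M0 by simp
    fix \<epsilon> :: real assume \<epsilon>: "0 < \<epsilon>"
    \<comment> \<open>The least integer above \<open>(M + 1) / \<epsilon>\<^sup>2\<close>: every
      \<open>k < K\<close> meets the required bound, while \<open>K\<close> gradients of norm at
      least \<epsilon> would push the sum of squares above \<open>M\<close>.\<close>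
    define K where "K = Suc (nat \<lfloor>(M + 1) / \<epsilon>\<^sup>2\<rfloor>)"
    have "0 \<le> (M + 1) / \<epsilon>\<^sup>2" using M0 by simp
    then have K: "(M + 1) / \<epsilon>\<^sup>2 < real K" "real K - 1 \<le> (M + 1) / \<epsilon>\<^sup>2"
      unfolding K_def by (simp_all add: of_nat_nat) linarith+
    have "\<exists>k<K. norm (grad_x \<Phi> (x k) (ystar (x k))) < \<epsilon>"
    proof (rule ccontr)
      assume "\<not> ?thesis"
      then have "(\<Sum>k<K. \<epsilon>\<^sup>2) \<le> (\<Sum>k<K. (norm (grad_x \<Phi> (x k) (ystar (x k))))\<^sup>2)"
        using \<epsilon> by (intro sum_mono power_mono) (simp_all, meson not_less)
      also note M[of K]
      finally have "real K * \<epsilon>\<^sup>2 \<le> M" by simp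
      moreover have "M + 1 < real K * \<epsilon>\<^sup>2"
        using K(1) \<epsilon> by (simp add: pos_divide_less_eq)
      ultimately show False by simp
    qed
    then obtain k where k: "k < K" "norm (grad_x \<Phi> (x k) (ystar (x k))) < \<epsilon>" by blast
    have "real k \<le> (M + 1) / \<epsilon>\<^sup>2" using k(1) K(2) by linarith
    moreover have "max_fun \<Phi> h differentiable (at (x k))"
      unfolding max_fun using phi_gderiv[of "x k"] by (auto simp: gderiv_def differentiable_def)
    moreover have "gradient (max_fun \<Phi> h) (x k) = grad_x \<Phi> (x k) (ystar (x k))"
      unfolding max_fun by (rule gradient_eqI[OF phi_gderiv])
    ultimately show "\<exists>k. real k \<le> (M + 1) / \<epsilon>\<^sup>2 \<and> max_fun \<Phi> h differentiable (at (x k)) \<and>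
        norm (gradient (max_fun \<Phi> h) (x k)) < \<epsilon>"
      using k(2) by auto
  qed
qed

end
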